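(* The $a$th Hopf-power Markov chain on the fundamental quasisymmetric functions $\{F_I\}$ tracks the descent set under ($a$-handed) riffle-shuffling of a distinct deck of cards. That is, let $P_a(w,w')$ denote the probability that an $a$-handed riffle-shuffle takes the deck $w$ to the deck $w'$, and let $K_{a,n}$ be the transition matrix of the $a$th Hopf-power Markov chain on compositions of $n$; then for every word $w$ with $n$ distinct letters and every composition $J$ of $n$, $$\sum_{w':\ \mathrm{Des}(w')=J}P_a(w,w')=K_{a,n}(\mathrm{Des}(w),J).$$ In particular, the descent set is a Markovian statistic of riffle-shuffling of a distinct deck of cards: if $\{X_m\}$ is the riffle-shuffling chain on orderings of a distinct deck, then $\{\mathrm{Des}(X_m)\}$ is a Markov chain.
   Context: A deck of $n$ distinct cards is identified with a word $w=w_1\cdots w_n$ of $n$ distinct letters, read from top to bottom. An $a$-handed riffle-shuffle of $w$: choose $(i_1,\dots,i_a)$, non-negative integers with $i_1+\dots+i_a=n$, with probability $a^{-n}\binom{n}{i_1\ \dots\ i_a}$; cut $w$ into consecutive subwords (piles) of lengths $i_1,\dots,i_a$; then choose uniformly among all interleavings of the $a$ piles (keeping the order within each pile). A composition of $n$ is a list $I=(i_1,\dots,i_{l(I)})$ of positive integers with sum $|I|=n$; $J\ge I$ means that $J$ refines $I$. For a word $w=w_1\cdots w_n$, the descent composition $\mathrm{Des}(w)=(i_1,\dots,i_l)$ is the composition of $n$ such that $w_r>w_{r+1}$ exactly when $r=i_1+\dots+i_j$ for some $1\le j<l$; it encodes the descent set of $w$. $QSym$ is the algebra of quasisymmetric functions: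 the subalgebra of the algebra of power series over $\mathbb{R}$ in commuting variables $x_1,x_2,\dots$ spanned by $M_I=\sum_{j_1<\dots<j_{l(I)}}x_{j_1}^{i_1}\cdots x_{j_{l(I)}}^{i_{l(I)}}$, with coproduct $\Delta(M_I)=\sum_{j=0}^{l(I)}M_{(i_1,\dots,i_j)}\otimes M_{(i_{j+1},\dots,i_{l(I)})}$. The fundamental quasisymmetric functions are $F_I=\sum_{J\ge I}M_J$. Let $\Psi^a=m^{[a]}\Delta^{[a]}$ be the $a$-fold coproduct followed by the $a$-fold product. The $a$th Hopf-power Markov chain on $\{F_I:|I|=n\}$ (on compositions of $n$) has transition matrix given by $a^{-n}\Psi^a(F_I)=\sum_{|J|=n}K_{a,n}(I,J)F_J$. (In general a Hopf-power Markov chain involves a rescaling of the basis by the function $\eta(x)$ equal to the sum of coefficients of the degree $(1,\dots,1)$ part of $\Delta^{[n]}(x)$; here $\eta(F_I)=1$ for all $I$.) *)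

theory Defs
  imports
    "HOL-Probability.Probability"
    "HOL-Combinatorics.Multiset_Permutations"
    "HOL-Library.Poly_Mapping"
    "HOL-Library.Function_Algebras"
begin

section \<open>Riffle shuffles\<close>

fun cut :: "nat list \<Rightarrow> 'a list \<Rightarrow> 'a list list" where
  "cut [] w = []"
| "cut (i # is) w = take i w # cut is (drop i w)"

text \<open>
  When the letters of all piles are pairwise distinct, different interleavings give different
  words, so that the set of resulting words faithfully represents the interleavings.
\<close>

fun interleavings :: "'a list list \<Rightarrow> 'a list set" where
  "interleavings [] = {[]}"
| "interleavings (p # ps) = (\<Union>v\<in>interleavings ps. shuffles p v)"

definition multinomial :: "nat list \<Rightarrow> real" where
  "multinomial is = fact (sum_list is) / prod_list (map fact is)"

text \<open>
  The sum over the pile sizes is the law of total probability: a cut \<open>is\<close> has probability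
  \<open>multinomial is / a ^ n\<close>, and given the cut every interleaving is equally likely.
\<close>

definition riffle_prob :: "nat \<Rightarrow> 'a list \<Rightarrow> 'a list \<Rightarrow> real" where
  "riffle_prob a w w' =
     (\<Sum>is | length is = a \<and> sum_list is = length w.
        multinomial is / real a ^ length w *
        (of_bool (w' \<in> interleavings (cut is w)) / real (card (interleavings (cut is w)))))"

lemma finite_cuts: "finite {is. length is = a \<and> sum_list is = (n :: nat)}"
proof (rule finite_subset)
  show "{is. length is = a \<and> sum_list is = n} \<subseteq> {is. set is \<subseteq> {..n} \<and> length is = a}"
    by (auto intro: member_le_sum_list)
  show "finite {is. set is \<subseteq> {..n} \<and> length is = a}"
    by (rule finite_lists_length_eq) simp
qed


section \<open>Compositions\<close>

definition compositions :: "nat \<Rightarrow> nat list set" where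
  "compositions n = {I. (\<forall>i\<in>set I. 0 < i) \<and> sum_list I = n}"

definition refines :: "nat list \<Rightarrow> nat list \<Rightarrow> bool" where
  "refines J I \<longleftrightarrow> (\<exists>Js. J = concat Js \<and> map sum_list Js = I)"

definition partial_sums :: "nat list \<Rightarrow> nat set" where
  "partial_sums I = {sum_list (take j I) | j. 1 \<le> j \<and> j < length I}"

text \<open>
  The letters of a word are numbered from 1 in \<open>partial_sums\<close>, but from 0 by the list
  indexing operation.
\<close>

definition is_descent_composition :: "'a::linorder list \<Rightarrow> nat list \<Rightarrow> bool" where
  "is_descent_composition w I \<longleftrightarrow>
     I \<in> compositions (length w) \<and>
     (\<forall>r. 1 \<le> r \<and> r < length w \<longrightarrow> (w ! (r - 1) > w ! r \<longleftrightarrow> r \<in> partial_sums I))"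

definition Des :: "'a::linorder list \<Rightarrow> nat list" where
  "Des w = (THE I. is_descent_composition w I)"

lemma finite_compositions [simp]: "finite (compositions n)"
proof (rule finite_subset)
  have "length I \<le> sum_list I" if "\<forall>i\<in>set I. 0 < i" for I :: "nat list"
    using that by (induction I) auto
  moreover have "set I \<subseteq> {..sum_list I}" for I :: "nat list"
    using member_le_sum_list by auto
  ultimately show "compositions n \<subseteq> {I. set I \<subseteq> {..n} \<and> length I \<le> n}"
    unfolding compositions_def by fastforce
  show "finite {I. set I \<subseteq> {..n} \<and> length I \<le> n}"
    by (rule finite_lists_length_le) simp
qed

lemma partial_sums_simps [simp]:
  "partial_sums [] = {}"
  "partial_sums [i] = {}"
  "partial_sums (i # k # I) = insert i ((+) i ` partial_sums (k # I))"
proof -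
  show "partial_sums [] = {}" "partial_sums [i] = {}"
    by (auto simp: partial_sums_def)
  show "partial_sums (i # k # I) = insert i ((+) i ` partial_sums (k # I))" (is "?L = ?R")
  proof (intro equalityI subsetI)
    fix x assume "x \<in> ?L"
    then obtain j where j: "1 \<le> j" "j < length (i # k # I)" "x = sum_list (take j (i # k # I))"
      unfolding partial_sums_def by blast
    then obtain j' where j': "j = Suc j'" by (cases j) auto
    show "x \<in> ?R"
    proof (cases "j' = 0")
      case False
      then have "sum_list (take j' (k # I)) \<in> partial_sums (k # I)"
        using j j' unfolding partial_sums_def by auto
      then show ?thesis using j j' by auto
    qed (use j j' in auto)
  next
    fix x assume "x \<in> ?R"
    then consider "x = i" | y where "y \<in> partial_sums (k # I)" "x = i + y" by blast
    then show "x \<in> ?L"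
    proof cases
      case 1
      then show ?thesis unfolding partial_sums_def by (auto intro!: exI[of _ 1])
    next
      case 2
      then obtain j where "1 \<le> j" "j < length (k # I)" "y = sum_list (take j (k # I))"
        unfolding partial_sums_def by blast
      then show ?thesis using 2 unfolding partial_sums_def by (auto intro!: exI[of _ "Suc j"])
    qed
  qed
qed

lemma partial_sums_bounds:
  assumes "\<forall>i\<in>set I. 0 < i" "r \<in> partial_sums I"
  shows "0 < r \<and> r < sum_list I"
  using assms
proof (induction I arbitrary: r)
  case (Cons i I)
  then show ?case by (cases I) fastforce+
qed simp

lemma partial_sums_inj:
  assumes "\<forall>i\<in>set I. 0 < i" "\<forall>i\<in>set J. 0 < i" "sum_list I = sum_list J"
    and "partial_sums I = partial_sums J"
  shows "I = J"
  using assms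
proof (induction I arbitrary: J)
  case Nil
  then show ?case by (cases J) auto
next
  case (Cons i I)
  obtain j J' where J: "J = j # J'"
    using Cons.prems by (cases J) auto
  show ?case
  proof (cases "I = [] \<or> J' = []")
    case True
    then consider "I = []" "J' = []" | k I2 where "I = k # I2" "J' = []"
      | k J2 where "I = []" "J' = k # J2"
      by (cases I; cases J') auto
    then show ?thesis
    proof cases
      case 1
      then show ?thesis using Cons.prems(3) J by simp
    next
      case 2
      then show ?thesis using Cons.prems(4) J by simp
    next
      case 3
      then show ?thesis using Cons.prems(4) J by simp
    qed
  next
    case False
    then obtain k I2 l J2 where eq: "I = k # I2" "J' = l # J2"
      by (meson neq_Nil_conv)
    define A where "A = partial_sums I"
    define B where "B = partial_sums J'"
    have AB: "insert i ((+) i ` A) = insert j ((+) j ` B)"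
      using Cons.prems(4) unfolding A_def B_def J eq partial_sums_simps .
    have "i \<in> insert j ((+) j ` B)" "j \<in> insert i ((+) i ` A)"
      unfolding AB[symmetric] by (simp, simp add: AB)
    then have ij: "i = j" by auto
    have "0 \<notin> A" "0 \<notin> B"
      using partial_sums_bounds[of I 0] partial_sums_bounds[of J' 0] Cons.prems(1,2) J
      unfolding A_def B_def by auto
    then have "i \<notin> (+) i ` A" "i \<notin> (+) i ` B"
      by auto
    then have "(+) i ` A = (+) i ` B"
      using AB unfolding ij[symmetric] by (simp add: insert_ident)
    then have "A = B"
      by (simp add: inj_image_eq_iff)
    then have "I = J'"
      using Cons.prems(1-3) J ij unfolding A_def B_def by (intro Cons.IH) auto
    then show ?thesis using J ij by simp
  qed
qed

lemma ex_descent_composition: "\<exists>I. is_descent_composition w I"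
proof (induction w rule: induct_list012)
  case 1
  show ?case by (intro exI[of _ "[]"]) (auto simp: is_descent_composition_def compositions_def)
next
  case (2 x)
  then show ?case
    by (intro exI[of _ "[1]"]) (auto simp: is_descent_composition_def compositions_def)
next
  case (3 x y w)
  then obtain I where I: "is_descent_composition (y # w) I" by blast
  then obtain k K where K: "I = k # K"
    by (cases I) (auto simp: is_descent_composition_def compositions_def)
  have desc: "(y # w) ! (r - 1) > (y # w) ! r \<longleftrightarrow> r \<in> partial_sums (k # K)"
    if "1 \<le> r" "r < length (y # w)" for r
    using I that unfolding is_descent_composition_def K by blast
  have pos: "\<forall>i\<in>set (k # K). 0 < i" and sum: "sum_list (k # K) = Suc (length w)"
    using I unfolding is_descent_composition_def compositions_def K by auto
  define I' where "I' = (if x > y then 1 # k # K else Suc k # K)"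
  have ps: "Suc r \<in> partial_sums I' \<longleftrightarrow> (if r = 0 then x > y else r \<in> partial_sums (k # K))" for r
    using pos partial_sums_bounds[OF pos, of r]
    by (cases K) (auto simp: I'_def image_iff)
  have "is_descent_composition (x # y # w) I'"
    unfolding is_descent_composition_def
  proof (intro conjI allI impI)
    show "I' \<in> compositions (length (x # y # w))"
      using pos sum by (auto simp: I'_def compositions_def)
  next
    fix r assume r: "1 \<le> r \<and> r < length (x # y # w)"
    then obtain q where q: "r = Suc q" by (cases r) auto
    show "(x # y # w) ! (r - 1) > (x # y # w) ! r \<longleftrightarrow> r \<in> partial_sums I'"
      using desc[of q] r unfolding q ps by (cases q) auto
  qed
  then show ?case by blast
qed

lemma is_descent_composition_Des: "is_descent_composition w (Des w)"
proof -
  have "I = J" if "is_descent_composition w I" "is_descent_composition w J" for I J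
  proof (rule partial_sums_inj)
    show pos: "\<forall>i\<in>set I. 0 < i" "\<forall>i\<in>set J. 0 < i" and sum: "sum_list I = sum_list J"
      using that by (auto simp: is_descent_composition_def compositions_def)
    have "1 \<le> r \<and> r < length w" if "r \<in> partial_sums I \<or> r \<in> partial_sums J" for r
      using that partial_sums_bounds[of I r] partial_sums_bounds[of J r] pos sum
        \<open>is_descent_composition w I\<close> by (auto simp: is_descent_composition_def compositions_def)
    then show "partial_sums I = partial_sums J"
      using that unfolding is_descent_composition_def by blast
  qed
  then show ?thesis
    unfolding Des_def using ex_descent_composition by (metis theI')
qed


section \<open>Quasisymmetric functions\<close>

instantiation "fun" :: (type, real_vector) real_vector
begin

definition scaleR_fun :: "real \<Rightarrow> ('a \<Rightarrow> 'b) \<Rightarrow> 'a \<Rightarrow> 'b" where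
  "scaleR_fun c f = (\<lambda>x. c *\<^sub>R f x)"

instance
  by standard (simp_all add: scaleR_fun_def fun_eq_iff scaleR_add_right scaleR_add_left)

end

text \<open>
  Power series in variables \<open>x\<^sub>0, x\<^sub>1, \<dots>\<close>, given by their coefficients.  The vector space
  structure is pointwise, but the pointwise multiplication of functions is \<^emph>\<open>not\<close> the
  multiplication of power series; the latter is \<open>series_mult\<close>.
\<close>

type_synonym monom = "nat \<Rightarrow>\<^sub>0 nat"
type_synonym series = "monom \<Rightarrow> real"

definition series_one :: series where
  "series_one m = of_bool (m = 0)"

definition series_mult :: "series \<Rightarrow> series \<Rightarrow> series" where
  "series_mult f g m = (\<Sum>(u, v)\<in>{(u, v). u + v = m}. f u * g v)"

definition series_prod_list :: "series list \<Rightarrow> series" where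
  "series_prod_list fs = foldr series_mult fs series_one"

text \<open>
  The coefficient of a monomial in \<open>mono_qs I\<close> counts the index sequences
  \<open>j\<^sub>1 < \<dots> < j\<^sub>l\<close> that contribute this monomial to \<open>M\<^sub>I\<close>.
\<close>

definition monomial :: "nat list \<Rightarrow> nat list \<Rightarrow> monom" where
  "monomial js I = sum_list (map2 Poly_Mapping.single js I)"

definition mono_qs :: "nat list \<Rightarrow> series" where
  "mono_qs I m =
     real (card {js. length js = length I \<and> sorted_wrt (<) js \<and> monomial js I = m})"

definition fund_qs :: "nat list \<Rightarrow> series" where
  "fund_qs I = (\<Sum>J | J \<in> compositions (sum_list I) \<and> refines J I. mono_qs J)"

text \<open>
  The \<open>k\<close>-th tensor power of QSym is realised inside the power series in \<open>k\<close> disjoint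
  alphabets: \<open>f\<^sub>1 \<otimes> \<dots> \<otimes> f\<^sub>k\<close> is the series whose coefficient at the \<open>k\<close>-tuple of
  monomials \<open>u\<^sub>1, \<dots>, u\<^sub>k\<close> (one for each alphabet) is the product of the coefficients of the
  \<open>f\<^sub>i\<close> at \<open>u\<^sub>i\<close>.  Tuples are lists, and an element of the \<open>k\<close>-th tensor power vanishes on the
  lists of any other length.
\<close>

type_synonym tensor = "monom list \<Rightarrow> real"

definition pure_tensor :: "series list \<Rightarrow> tensor" where
  "pure_tensor fs us =
     (if length us = length fs then \<Prod>i<length fs. (fs ! i) (us ! i) else 0)"

text \<open>The tensor product of an element of the second tensor power with any tensor.\<close>

definition tensor_append2 :: "tensor \<Rightarrow> tensor \<Rightarrow> tensor" where
  "tensor_append2 S T us = S (take 2 us) * T (drop 2 us)"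

definition mono_index :: "nat list set" where
  "mono_index = (\<Union>n. compositions n)"

definition tensor_index :: "nat \<Rightarrow> nat list list set" where
  "tensor_index k = {Is. length Is = k \<and> set Is \<subseteq> mono_index}"

definition mono_tensor :: "nat list list \<Rightarrow> tensor" where
  "mono_tensor Is = pure_tensor (map mono_qs Is)"

text \<open>
  The linear map that sends \<open>b i\<close> to \<open>g i\<close> for all \<open>i \<in> S\<close>, where \<open>b\<close> is a basis of the
  domain indexed by \<open>S\<close>; only its values on the span of \<open>b ` S\<close> are of interest.  QSym is
  the span of \<open>mono_qs ` mono_index\<close>, and its \<open>k\<close>-th tensor power is the span of
  \<open>mono_tensor ` tensor_index k\<close>.  That these are bases is proved below.
\<close>

definition linear_ext ::
    "('i \<Rightarrow> 'v::real_vector) \<Rightarrow> 'i set \<Rightarrow> ('i \<Rightarrow> 'w::real_vector) \<Rightarrow> 'v \<Rightarrow> 'w" where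
  "linear_ext b S g = construct (b ` S) (g \<circ> inv_into S b)"

definition coproduct :: "series \<Rightarrow> tensor" where
  "coproduct = linear_ext mono_qs mono_index
     (\<lambda>I. \<Sum>j\<le>length I. pure_tensor [mono_qs (take j I), mono_qs (drop j I)])"

text \<open>The map \<open>\<Delta> \<otimes> id \<otimes> \<dots> \<otimes> id\<close> from the \<open>k\<close>-th to the \<open>(k + 1)\<close>-st tensor power.\<close>

definition coproduct_first :: "nat \<Rightarrow> tensor \<Rightarrow> tensor" where
  "coproduct_first k = linear_ext mono_tensor (tensor_index k)
     (\<lambda>Is. tensor_append2 (coproduct (mono_qs (hd Is))) (mono_tensor (tl Is)))"

text \<open>
  The \<open>k\<close>-fold coproduct maps QSym to its \<open>k\<close>-th tensor power, so it is the identity for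
  \<open>k = 1\<close> and the coproduct for \<open>k = 2\<close>; it is left unspecified for \<open>k = 0\<close>.
\<close>

fun coproduct_iter :: "nat \<Rightarrow> series \<Rightarrow> tensor" where
  "coproduct_iter (Suc 0) f = pure_tensor [f]"
| "coproduct_iter (Suc (Suc k)) f = coproduct_first (Suc k) (coproduct_iter (Suc k) f)"

definition product_iter :: "nat \<Rightarrow> tensor \<Rightarrow> series" where
  "product_iter k = linear_ext mono_tensor (tensor_index k)
     (\<lambda>Is. series_prod_list (map mono_qs Is))"

definition hopf_power :: "nat \<Rightarrow> series \<Rightarrow> series" where
  "hopf_power a f = product_iter a (coproduct_iter a f)"

text \<open>
  The entry at \<open>I, J\<close> is the coefficient of \<open>F\<^sub>J\<close> in the expansion of
  \<open>a\<^sup>-\<^sup>n \<Psi>\<^sup>a(F\<^sub>I)\<close> in the fundamental basis.  The general rescaling of the basis is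
  trivial here.  \<open>representation\<close> yields 0 for vectors outside the span of an independent set.
\<close>

definition hopf_power_matrix :: "nat \<Rightarrow> nat \<Rightarrow> nat list \<Rightarrow> nat list \<Rightarrow> real" where
  "hopf_power_matrix a n I J =
     representation (fund_qs ` compositions n)
       ((1 / real a ^ n) *\<^sub>R hopf_power a (fund_qs I)) (fund_qs J)"

lemma linear_linear_ext:
  assumes "independent (b ` S)"
  shows "linear (linear_ext b S g)"
  unfolding linear_ext_def using assms by (rule real_vector.linear_construct)

lemma linear_ext_basis:
  assumes "independent (b ` S)" "inj_on b S" "i \<in> S"
  shows "linear_ext b S g (b i) = g i"
  unfolding linear_ext_def using assms by (simp add: real_vector.construct_basis)

lemma independent_dual_points:
  fixes b :: "'i \<Rightarrow> 'x \<Rightarrow> real"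
  assumes dual: "\<And>i j. i \<in> S \<Longrightarrow> j \<in> S \<Longrightarrow> b i (p j) = of_bool (i = j)"
  shows "inj_on b S" and "independent (b ` S)"
proof -
  show inj: "inj_on b S"
    by (rule inj_onI) (metis dual of_bool_eq_1_iff)
  show "independent (b ` S)"
    unfolding independent_explicit_module
  proof (intro allI impI)
    fix T u v
    assume T: "finite T" "T \<subseteq> b ` S" and 0: "(\<Sum>v\<in>T. u v *\<^sub>R v) = 0" and v: "v \<in> T"
    obtain j where j: "j \<in> S" "v = b j" using T v by blast
    have eval: "(\<Sum>v\<in>T. u v *\<^sub>R v) x = (\<Sum>v\<in>T. u v * v x)" for x
      using T(1) by (induction T) (auto simp: scaleR_fun_def)
    have "0 = (\<Sum>v'\<in>T. u v' * v' (p j))"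
      using eval[of "p j"] 0 by simp
    also have "\<dots> = (\<Sum>v'\<in>T. if v' = v then u v' else 0)"
    proof (rule sum.cong)
      fix v' assume "v' \<in> T"
      then obtain i where "i \<in> S" "v' = b i" using T by blast
      then show "u v' * v' (p j) = (if v' = v then u v' else 0)"
        using dual[of i j] j inj by (auto dest: inj_onD)
    qed simp
    also have "\<dots> = u v" using T v by simp
    finally show "u v = 0" by simp
  qed
qed

text \<open>The sum in \<open>series_mult\<close> is finite:\<close>

lemma finite_monom_splits: "finite {(u, v). u + v = (m :: monom)}"
proof (rule finite_subset)
  define A where "A = {u :: monom. \<forall>j. Poly_Mapping.lookup u j \<le> Poly_Mapping.lookup m j}"
  define B where "B = Max (Poly_Mapping.lookup m ` Poly_Mapping.keys m)"
  have "f j \<in> {..B}" if "u \<in> A" "f = Poly_Mapping.lookup u" "j \<in> Poly_Mapping.keys m" for u f j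
  proof -
    have "f j \<le> Poly_Mapping.lookup m j" using that by (simp add: A_def)
    also have "\<dots> \<le> B" unfolding B_def using that(3) by (intro Max_ge) auto
    finally show ?thesis by simp
  qed
  moreover have "f j = 0"
    if "u \<in> A" "f = Poly_Mapping.lookup u" "j \<notin> Poly_Mapping.keys m" for u f j
  proof -
    have "f j \<le> Poly_Mapping.lookup m j" using that by (simp add: A_def)
    then show ?thesis using that(3) by (simp add: Poly_Mapping.in_keys_iff)
  qed
  ultimately have "Poly_Mapping.lookup ` A \<subseteq> {f. \<forall>j. (j \<in> Poly_Mapping.keys m \<longrightarrow> f j \<in> {..B}) \<and>
      (j \<notin> Poly_Mapping.keys m \<longrightarrow> f j = 0)}" (is "_ \<subseteq> ?C")
    by (intro subsetI CollectI allI conjI impI) (erule imageE, meson)+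
  moreover have "finite ?C"
    by (rule finite_set_of_finite_funs) (rule Poly_Mapping.finite_keys, rule finite_atMost)
  ultimately have "finite (Poly_Mapping.lookup ` A)"
    by (rule finite_subset)
  moreover have "inj_on Poly_Mapping.lookup A"
    by (rule inj_onI) (rule Poly_Mapping.lookup_inject[THEN iffD1])
  ultimately have fin: "finite A"
    by (rule finite_imageD)
  show "finite (A \<times> A)" using fin by simp
  show "{(u, v). u + v = m} \<subseteq> A \<times> A"
    by (auto simp: A_def lookup_add)
qed

lemma lookup_monomial_notin:
  assumes "length js = length I" "j \<notin> set js"
  shows "Poly_Mapping.lookup (monomial js I) j = 0"
  using assms
  by (induction js I rule: list_induct2)
    (auto simp: monomial_def lookup_add lookup_single when_def)

lemma lookup_monomial_nth:
  assumes "length js = length I" "distinct js" "k < length js"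
  shows "Poly_Mapping.lookup (monomial js I) (js ! k) = I ! k"
  using assms
proof (induction js I arbitrary: k rule: list_induct2)
  case (Cons i js x I)
  have "Poly_Mapping.lookup (monomial (i # js) (x # I)) j =
      (if i = j then x else 0) + Poly_Mapping.lookup (monomial js I) j" for j
    by (simp add: monomial_def lookup_add lookup_single when_def)
  then show ?case
    using Cons lookup_monomial_notin[of js I i] by (cases k) auto
qed simp

lemma mono_qs_dual:
  assumes "I \<in> mono_index" "J \<in> mono_index"
  shows "mono_qs I (monomial [0..<length J] J) = of_bool (I = J)"
proof -
  have posI: "0 < I ! k" if "k < length I" for k
    using assms that by (auto simp: mono_index_def compositions_def)
  have posJ: "0 < J ! k" if "k < length J" for k
    using assms that by (auto simp: mono_index_def compositions_def)
  have "js = [0..<length J] \<and> I = J"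
    if js: "length js = length I" "sorted_wrt (<) js"
      and eq: "monomial js I = monomial [0..<length J] J" for js
  proof -
    have dist: "distinct js" using js by (simp add: strict_sorted_iff)
    have J: "Poly_Mapping.lookup (monomial js I) j = (if j < length J then J ! j else 0)" for j
      unfolding eq using lookup_monomial_notin[of "[0..<length J]" J j] lookup_monomial_nth[of "[0..<length J]" J j]
      by auto
    have "j \<in> set js \<longleftrightarrow> 0 < Poly_Mapping.lookup (monomial js I) j" for j
      using lookup_monomial_notin[OF js(1)] lookup_monomial_nth[OF js(1) dist] posI js(1)
      by (metis in_set_conv_nth less_irrefl)
    then have "set js = {0..<length J}"
      unfolding J using posJ by (auto split: if_splits)
    then have *: "js = [0..<length J]"
      using js(2) by (intro strict_sorted_equal) (simp_all add: sorted_wrt_upt)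
    moreover have "I = J"
    proof (rule nth_equalityI)
      show len: "length I = length J" using js(1) * by simp
      show "I ! k = J ! k" if "k < length I" for k
        using lookup_monomial_nth[OF js(1) dist, of k] J[of k] that len * by simp
    qed
    ultimately show ?thesis by simp
  qed
  then have "{js. length js = length I \<and> sorted_wrt (<) js \<and>
      monomial js I = monomial [0..<length J] J} = (if I = J then {[0..<length J]} else {})"
    by auto
  then show ?thesis by (simp add: mono_qs_def)
qed

lemma mono_qs_basis: "inj_on mono_qs mono_index" "independent (mono_qs ` mono_index)"
  using independent_dual_points[of mono_index mono_qs "\<lambda>J. monomial [0..<length J] J",
      OF mono_qs_dual] by simp_all

lemma mono_tensor_basis:
  "inj_on mono_tensor (tensor_index k)" "independent (mono_tensor ` tensor_index k)"
proof -
  have *: "mono_tensor Is (map (\<lambda>J. monomial [0..<length J] J) Js) = of_bool (Is = Js)"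
    if "Is \<in> tensor_index k" "Js \<in> tensor_index k" for Is Js
  proof -
    have len: "length Is = k" "length Js = k" using that by (auto simp: tensor_index_def)
    have "mono_tensor Is (map (\<lambda>J. monomial [0..<length J] J) Js) =
        (\<Prod>i<k. mono_qs (Is ! i) (monomial [0..<length (Js ! i)] (Js ! i)))"
      using len by (simp add: mono_tensor_def pure_tensor_def)
    also have "\<dots> = (\<Prod>i<k. of_bool (Is ! i = Js ! i))"
      by (rule prod.cong, simp, rule mono_qs_dual)
        (use that len in \<open>auto simp: tensor_index_def\<close>)
    also have "\<dots> = of_bool (\<forall>i<k. Is ! i = Js ! i)"
      by (auto simp: prod_zero_iff)
    also have "(\<forall>i<k. Is ! i = Js ! i) \<longleftrightarrow> Is = Js"
      using len by (auto intro: nth_equalityI)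
    finally show ?thesis .
  qed
  note dual = independent_dual_points[of "tensor_index k" mono_tensor
      "map (\<lambda>J. monomial [0..<length J] J)", OF *]
  show "inj_on mono_tensor (tensor_index k)" by (rule dual(1))
  show "independent (mono_tensor ` tensor_index k)" by (rule dual(2))
qed


section \<open>Markov chains on a finite state space\<close>

definition stochastic_on :: "'s set \<Rightarrow> ('s \<Rightarrow> 's \<Rightarrow> real) \<Rightarrow> bool" where
  "stochastic_on S K \<longleftrightarrow>
     (\<forall>x\<in>S. (\<forall>y\<in>S. 0 \<le> K x y) \<and> (\<Sum>y\<in>S. K x y) = 1)"

text \<open>
  A time-homogeneous Markov chain with transition matrix \<open>K\<close> and arbitrary initial
  distribution, as a sequence of random variables on an arbitrary probability space.
\<close>

definition markov_chain ::
    "'w measure \<Rightarrow> 's set \<Rightarrow> ('s \<Rightarrow> 's \<Rightarrow> real) \<Rightarrow> (nat \<Rightarrow> 'w \<Rightarrow> 's) \<Rightarrow> bool" where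
  "markov_chain M S K X \<longleftrightarrow>
     prob_space M \<and> finite S \<and> stochastic_on S K \<and>
     (\<forall>m. X m \<in> measurable M (count_space S)) \<and>
     (\<forall>m x y. (\<forall>i\<le>m. x i \<in> S) \<and> y \<in> S \<and> \<P>(\<omega> in M. \<forall>i\<le>m. X i \<omega> = x i) > 0 \<longrightarrow>
        \<P>(\<omega> in M. X (Suc m) \<omega> = y \<bar> \<forall>i\<le>m. X i \<omega> = x i) = K (x m) y)"

end

theory Submission
  imports Defs
begin

text \<open>
  \<open>M\<^sub>J\<close> occurs in \<open>F\<^bsub>Des w\<^esub>\<close> iff every block of \<open>w\<close> cut out by \<open>J\<close> is increasing.
  Deconcatenating \<open>J\<close> therefore amounts to cutting \<open>w\<close>, and the iterated coproduct of
  \<open>F\<^bsub>Des w\<^esub>\<close> is the sum of \<open>F\<^bsub>Des w1\<^esub> \<otimes> \<dots> \<otimes> F\<^bsub>Des wa\<^esub>\<close> over all cuts of \<open>w\<close> into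
  \<open>a\<close> piles.  For the product, \<open>F\<^bsub>Des w\<^esub>\<close> is the generating function of the colourings \<open>g\<close> of
  the letters for which \<open>w\<close> lists its letters \<open>x\<close> in increasing lexicographic order of \<open>(g x, x)\<close>.
  A colouring of disjoint \<open>u\<close> and \<open>v\<close> that is good for both is good for exactly one shuffle of
  them, hence \<open>F\<^bsub>Des u\<^esub> F\<^bsub>Des v\<^esub>\<close> is the sum of \<open>F\<^bsub>Des w\<^esub>\<close> over the shuffles \<open>w\<close>.
  As the multinomial coefficient counts the interleavings of a cut, all pairs of a cut and an
  interleaving have probability \<open>a\<^sup>-\<^sup>n\<close>, so that \<open>a\<^sup>-\<^sup>n \<Psi>\<^sup>a(F\<^bsub>Des w\<^esub>)\<close> is the expectation of
  \<open>F\<^bsub>Des w'\<^esub>\<close> for the shuffled deck \<open>w'\<close>.  Since every composition is the descent composition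
  of some deck, the Markov property follows by lumping.
\<close>

section \<open>Descent compositions\<close>

lemma sum_fun_apply: "(\<Sum>i\<in>A. f i) x = (\<Sum>i\<in>A. f i x)"
  for f :: "'i \<Rightarrow> 'x \<Rightarrow> 'b::comm_monoid_add"
  by (induction A rule: infinite_finite_induct) auto

section \<open>Refinement of compositions as inclusion of partial sums\<close>

lemma partial_sums_Cons:
  "partial_sums (i # I) = (if I = [] then {} else insert i ((+) i ` partial_sums I))"
  by (cases I) auto

lemma partial_sums_append:
  assumes "J \<noteq> []" "K \<noteq> []"
  shows "partial_sums (J @ K) =
    partial_sums J \<union> insert (sum_list J) ((+) (sum_list J) ` partial_sums K)"
  using assms
proof (induction J)
  case (Cons i J)
  then show ?case
    by (cases "J = []") (auto simp: partial_sums_Cons image_Un image_image add.assoc)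
qed simp

lemma in_partial_sums_split:
  assumes "r \<in> partial_sums J"
  obtains J1 J2 where "J = J1 @ J2" "J1 \<noteq> []" "J2 \<noteq> []" "sum_list J1 = r"
proof -
  from assms obtain j where "1 \<le> j" "j < length J" "r = sum_list (take j J)"
    unfolding partial_sums_def by blast
  then show ?thesis
    by (intro that[of "take j J" "drop j J"]) auto
qed

text \<open>Each proper partial sum of the block sums is reached by \<open>concat Js\<close> at the
  end of a block. Empty blocks are excluded because a block sum 0 could put the value 0 into the
  left-hand side.\<close>

lemma partial_sums_concat_subset:
  assumes "\<forall>K\<in>set Js. K \<noteq> []"
  shows "partial_sums (map sum_list Js) \<subseteq> partial_sums (concat Js)"
  using assms
proof (induction Js)
  case (Cons K Js)
  show ?case
  proof (cases "Js = []")
    case False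
    moreover have "K \<noteq> []" "concat Js \<noteq> []"
      using False Cons.prems by (auto simp: neq_Nil_conv)
    ultimately show ?thesis
      using Cons by (auto simp: partial_sums_Cons partial_sums_append simp del: concat_eq_Nil_conv)
  qed simp
qed simp

text \<open>Refining a composition adds partial sums and keeps the old ones. Conversely, if
  \<open>I\<close> has more than one part, its first part is a partial sum of \<open>J\<close>, so
  \<open>J\<close> can be split there and the rest is handled by induction.\<close>

lemma refines_iff_partial_sums:
  assumes "I \<in> compositions n" "J \<in> compositions n"
  shows "refines J I \<longleftrightarrow> partial_sums I \<subseteq> partial_sums J"
proof
  assume "refines J I"
  then obtain Js where Js: "J = concat Js" "I = map sum_list Js"
    by (auto simp: refines_def)
  moreover have "\<forall>K\<in>set Js. K \<noteq> []"
    using assms(1) Js by (fastforce simp: compositions_def)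
  ultimately show "partial_sums I \<subseteq> partial_sums J"
    using partial_sums_concat_subset by blast
next
  have "\<exists>Js. J = concat Js \<and> map sum_list Js = I"
    if "\<forall>i\<in>set I. 0 < i" "\<forall>i\<in>set J. 0 < i" "sum_list I = sum_list J"
      "partial_sums I \<subseteq> partial_sums J"
    using that
  proof (induction I arbitrary: J)
    case Nil
    then show ?case by (cases J) auto
  next
    case (Cons i I)
    show ?case
    proof (cases "I = []")
      case True
      then show ?thesis using Cons.prems by (intro exI[of _ "[J]"]) auto
    next
      case False
      then have "i \<in> partial_sums J"
        using Cons.prems(4) by (auto simp: partial_sums_Cons)
      then obtain J1 J2 where J: "J = J1 @ J2" "J1 \<noteq> []" "J2 \<noteq> []" "sum_list J1 = i"
        by (rule in_partial_sums_split)
      \<comment> \<open>The values \<open>i + r\<close> with \<open>r > 0\<close> exceed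
        \<open>i\<close> and all partial sums of \<open>J1\<close>, so in \<open>J1 @ J2\<close>
        they can only come from \<open>J2\<close>.\<close>
      have "partial_sums I \<subseteq> partial_sums J2"
      proof
        fix r assume r: "r \<in> partial_sums I"
        then have r0: "r > 0"
          using partial_sums_bounds[of I r] Cons.prems(1) by auto
        have "i + r \<in> partial_sums J"
          using Cons.prems(4) r False by (auto simp: partial_sums_Cons)
        moreover have "s < i" if "s \<in> partial_sums J1" for s
          using partial_sums_bounds[of J1 s] that Cons.prems(2) J by auto
        ultimately show "r \<in> partial_sums J2"
          using J r0 by (fastforce simp: partial_sums_append)
      qed
      then obtain Js where "J2 = concat Js" "map sum_list Js = I"
        using Cons.IH[of J2] Cons.prems J by auto
      then show ?thesis using J by (intro exI[of _ "J1 # Js"]) auto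
    qed
  qed
  then show "refines J I" if "partial_sums I \<subseteq> partial_sums J"
    using that assms by (auto simp: refines_def compositions_def)
qed

section \<open>Increasing blocks and descents\<close>

text \<open>Split \<open>w\<close> after its first block. Positions before \<open>i\<close> are
  never partial sums, so the block must have no descent; the boundary position \<open>i\<close> is
  unconstrained; later positions are shifted positions of the remaining word, covered by
  induction.\<close>

lemma all_sorted_cut_iff:
  fixes w :: "'a::linorder list"
  assumes "J \<in> compositions (length w)"
  shows "(\<forall>p\<in>set (cut J w). sorted p) \<longleftrightarrow>
     (\<forall>r. 1 \<le> r \<and> r < length w \<and> w ! (r - 1) > w ! r \<longrightarrow> r \<in> partial_sums J)"
  using assms
proof (induction J arbitrary: w)
  case Nil
  then show ?case by (auto simp: compositions_def)
next
  case (Cons i J)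
  define u where "u = take i w"
  define v where "v = drop i w"
  have w: "w = u @ v" by (simp add: u_def v_def)
  have len: "length u = i" "length v = sum_list J" and i: "0 < i" and J: "\<forall>j\<in>set J. 0 < j"
    using Cons.prems by (auto simp: compositions_def u_def v_def)
  have IH: "(\<forall>p\<in>set (cut J v). sorted p) \<longleftrightarrow>
     (\<forall>r. 1 \<le> r \<and> r < length v \<and> v ! (r - 1) > v ! r \<longrightarrow> r \<in> partial_sums J)"
    by (rule Cons.IH) (use len J in \<open>auto simp: compositions_def\<close>)
  have u: "sorted u \<longleftrightarrow> (\<forall>r. 1 \<le> r \<and> r < i \<longrightarrow> u ! (r - 1) \<le> u ! r)"
    unfolding sorted_iff_nth_Suc len(1)
  proof (intro iffI allI impI)
    show "u ! (r - 1) \<le> u ! r"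
      if "\<forall>k. Suc k < i \<longrightarrow> u ! k \<le> u ! Suc k" "1 \<le> r \<and> r < i" for r
      using that(1)[rule_format, of "r - 1"] that(2) by simp
    show "u ! k \<le> u ! Suc k"
      if "\<forall>r. 1 \<le> r \<and> r < i \<longrightarrow> u ! (r - 1) \<le> u ! r" "Suc k < i" for k
      using that(1)[rule_format, of "Suc k"] that(2) by simp
  qed
  have "(\<forall>r. 1 \<le> r \<and> r < length w \<and> w ! (r - 1) > w ! r \<longrightarrow> r \<in> partial_sums (i # J)) \<longleftrightarrow>
    (\<forall>r. 1 \<le> r \<and> r < i \<longrightarrow> u ! (r - 1) \<le> u ! r) \<and>
    (\<forall>r. 1 \<le> r \<and> r < length v \<and> v ! (r - 1) > v ! r \<longrightarrow> r \<in> partial_sums J)"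
    (is "(\<forall>r. ?P r) \<longleftrightarrow> (\<forall>r. ?Q r) \<and> (\<forall>r. ?R r)")
  proof -
    have P1: "?P r \<longleftrightarrow> ?Q r" if "r < i" for r
    proof -
      have "r \<notin> partial_sums (i # J)"
        using that by (auto simp: partial_sums_Cons)
      then show ?thesis
        using that len by (auto simp: w nth_append not_less)
    qed
    have P2: "?P (i + r) \<longleftrightarrow> ?R r" if "r > 0" for r
      using that len i by (auto simp: w nth_append partial_sums_Cons)
    \<comment> \<open>If \<open>J\<close> is empty, the word ends at \<open>i\<close> and there is
      no such position; otherwise \<open>i\<close> is the first partial sum.\<close>
    have P3: "?P i"
      using len by (cases "J = []") (auto simp: w partial_sums_Cons)
    show ?thesis
    proof safe
      fix r assume all: "\<forall>r. ?P r"
      show "u ! (r - 1) \<le> u ! r" if "1 \<le> r" "r < i" using P1[of r] all that by blast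
      show "r \<in> partial_sums J" if "1 \<le> r" "r < length v" "v ! (r - 1) > v ! r"
        using P2[of r] all that by auto
    next
      fix r assume a: "\<forall>r. ?Q r" "\<forall>r. ?R r"
      assume r: "1 \<le> r" "r < length w" "w ! (r - 1) > w ! r"
      consider "r < i" | "r = i" | s where "s > 0" "r = i + s"
        by (metis less_imp_add_positive linorder_neqE_nat)
      then have "?P r"
      proof cases
        case 1 then show ?thesis using P1 a by blast
      next
        case 2 then show ?thesis using P3 by blast
      next
        case 3 then show ?thesis using P2[of s] a(2) by blast
      qed
      then show "r \<in> partial_sums (i # J)" using r by blast
    qed
  qed
  then show ?case
    using u IH by (simp add: u_def v_def)
qed

text \<open>The index set of the monomial expansion of \<open>fund_qs (Des w)\<close>, described
  through cuts of the deck so that deconcatenation becomes a statement about piles.\<close>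

definition sorted_cuts :: "'a::linorder list \<Rightarrow> nat list set" where
  "sorted_cuts w = {J \<in> compositions (length w). \<forall>p\<in>set (cut J w). sorted p}"

lemma finite_sorted_cuts [simp]: "finite (sorted_cuts w)"
  by (simp add: sorted_cuts_def)

lemma Des_in_compositions: "Des w \<in> compositions (length w)"
  using is_descent_composition_Des[of w] by (simp add: is_descent_composition_def)

text \<open>Both conditions on \<open>J\<close> say that every descent position of \<open>w\<close>
  is a partial sum of \<open>J\<close>.\<close>

lemma sorted_cuts_eq: "sorted_cuts w = {J \<in> compositions (length w). refines J (Des w)}"
proof -
  have "(\<forall>p\<in>set (cut J w). sorted p) \<longleftrightarrow> refines J (Des w)"
    if "J \<in> compositions (length w)" for J
  proof -
    have "r \<in> partial_sums (Des w) \<longleftrightarrow> 1 \<le> r \<and> r < length w \<and> w ! (r - 1) > w ! r" for r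
      using is_descent_composition_Des[of w] partial_sums_bounds[of "Des w" r]
      unfolding is_descent_composition_def compositions_def by auto
    then show ?thesis
      unfolding all_sorted_cut_iff[OF that] refines_iff_partial_sums[OF Des_in_compositions that]
      by blast
  qed
  then show ?thesis by (auto simp: sorted_cuts_def)
qed

lemma fund_qs_Des: "fund_qs (Des w) = (\<Sum>J\<in>sorted_cuts w. mono_qs J)"
  using Des_in_compositions[of w] by (simp add: fund_qs_def sorted_cuts_eq compositions_def)

lemma is_descent_composition_unique:
  assumes "is_descent_composition w I"
  shows "Des w = I"
proof (rule partial_sums_inj)
  have "r \<in> partial_sums I \<longleftrightarrow> 1 \<le> r \<and> r < length w \<and> w ! (r - 1) > w ! r"
    if "is_descent_composition w I" for r I
    using that partial_sums_bounds[of I r]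
    unfolding is_descent_composition_def compositions_def by auto
  then show "partial_sums (Des w) = partial_sums I"
    using assms is_descent_composition_Des[of w] by blast
qed (use assms Des_in_compositions[of w] in \<open>auto simp: is_descent_composition_def compositions_def\<close>)

section \<open>Decks with a prescribed descent composition\<close>

text \<open>The block \<open>p\<close> has no inner descent, the inequality at the joint creates one
  at position \<open>length p\<close>, and the descents of \<open>w\<close> are shifted by that
  amount. For empty \<open>w\<close> there is no joint and \<open>I\<close> is empty.\<close>

lemma is_descent_composition_append:
  assumes p: "sorted p" "p \<noteq> []" and I: "is_descent_composition w I"
    and less: "w \<noteq> [] \<Longrightarrow> hd w < last p"
  shows "is_descent_composition (p @ w) (length p # I)"
  unfolding is_descent_composition_def
proof (intro conjI allI impI)
  show "length p # I \<in> compositions (length (p @ w))"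
    using p I by (auto simp: is_descent_composition_def compositions_def)
  fix r assume r: "1 \<le> r \<and> r < length (p @ w)"
  have Iw: "I = [] \<longleftrightarrow> w = []"
    using I by (cases I; cases w) (auto simp: is_descent_composition_def compositions_def)
  have pos: "0 \<notin> partial_sums I"
    using I partial_sums_bounds[of I 0] by (auto simp: is_descent_composition_def compositions_def)
  consider "r < length p" | "r = length p" | s where "s > 0" "r = length p + s"
    by (metis less_imp_add_positive linorder_neqE_nat)
  then show "(p @ w) ! (r - 1) > (p @ w) ! r \<longleftrightarrow> r \<in> partial_sums (length p # I)"
  proof cases
    case 1
    then have "p ! (r - 1) \<le> p ! r" using p by (intro sorted_nth_mono) auto
    then show ?thesis using 1 by (auto simp: nth_append partial_sums_Cons)
  next
    case 2
    then show ?thesis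
      using r p less Iw by (auto simp: nth_append partial_sums_Cons hd_conv_nth last_conv_nth)
  next
    case 3
    then have "w ! (s - 1) > w ! s \<longleftrightarrow> s \<in> partial_sums I"
      using I r by (auto simp: is_descent_composition_def)
    then show ?thesis
      using 3 Iw r by (auto simp: nth_append partial_sums_Cons)
  qed
qed

text \<open>The blocks of the witness are increasing, and each lies above all later ones.\<close>

lemma Des_surj:
  fixes D :: "'a::linorder set"
  assumes "finite D" "I \<in> compositions (card D)"
  shows "\<exists>w\<in>permutations_of_set D. Des w = I"
proof -
  have "\<exists>w\<in>permutations_of_set D. is_descent_composition w I"
    using assms
  proof (induction I arbitrary: D)
    case Nil
    then show ?case
      by (auto simp: compositions_def is_descent_composition_def)
  next
    case (Cons i I)
    define xs where "xs = sorted_list_of_set D"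
    have xs: "sorted xs" "distinct xs" "set xs = D" "length xs = card D"
      using Cons.prems by (simp_all add: xs_def)
    define q where "q = take (sum_list I) xs"
    define p where "p = drop (sum_list I) xs"
    have pq: "xs = q @ p" by (simp add: p_def q_def)
    have len: "length p = i" "length q = sum_list I" and i: "i > 0"
      using Cons.prems xs by (auto simp: compositions_def p_def q_def)
    have "card (set q) = sum_list I"
      using xs(2) len(2) unfolding pq by (simp add: distinct_card)
    then have "I \<in> compositions (card (set q))"
      using Cons.prems(2) by (simp add: compositions_def)
    then obtain w where w: "w \<in> permutations_of_set (set q)" "is_descent_composition w I"
      using Cons.IH[of "set q"] by auto
    have "is_descent_composition (p @ w) (length p # I)"
    proof (rule is_descent_composition_append[OF _ _ w(2)])
      show "sorted p" "p \<noteq> []" using xs(1) len i unfolding pq by (auto simp: sorted_append)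
      assume "w \<noteq> []"
      then have "hd w \<in> set q" "last p \<in> set p"
        using \<open>p \<noteq> []\<close> permutations_of_setD(1)[OF w(1)] hd_in_set[of w] by simp_all
      moreover have "x \<le> y" "x \<noteq> y" if "x \<in> set q" "y \<in> set p" for x y
        using xs(1,2) that unfolding pq by (auto simp: sorted_append)
      ultimately show "hd w < last p"
        by (simp add: order.strict_iff_order)
    qed
    moreover have "p @ w \<in> permutations_of_set D"
      using w(1) xs(2,3) unfolding pq permutations_of_set_def by auto
    ultimately show ?case using len by auto
  qed
  then show ?thesis using is_descent_composition_unique by blast
qed

section \<open>The Hopf power\<close>

lemma linear_pure_tensor_single: "linear (\<lambda>f. pure_tensor [f])"
  by (rule linearI) (auto simp: pure_tensor_def fun_eq_iff scaleR_fun_def)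

text \<open>Indexed by \<open>Suc k\<close> because the zero-fold coproduct is unspecified.\<close>

lemma linear_coproduct_iter: "linear (coproduct_iter (Suc k))"
proof (induction k)
  case 0
  then show ?case using linear_pure_tensor_single by simp
next
  case (Suc k)
  have "coproduct_iter (Suc (Suc k)) = coproduct_first (Suc k) \<circ> coproduct_iter (Suc k)"
    by (simp add: fun_eq_iff)
  show ?case
    unfolding \<open>coproduct_iter (Suc (Suc k)) = _\<close> coproduct_first_def
    by (rule linear_compose[OF Suc linear_linear_ext[OF mono_tensor_basis(2)]])
qed

lemma linear_hopf_power:
  assumes "1 \<le> a"
  shows "linear (hopf_power a)"
proof -
  obtain k where "a = Suc k" using assms by (cases a) auto
  moreover have "hopf_power a = product_iter a \<circ> coproduct_iter a"
    by (simp add: fun_eq_iff hopf_power_def)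
  ultimately show ?thesis
    unfolding product_iter_def
    using linear_compose[OF linear_coproduct_iter linear_linear_ext[OF mono_tensor_basis(2)]] by simp
qed

lemma mono_index_iff: "I \<in> mono_index \<longleftrightarrow> (\<forall>i\<in>set I. 0 < i)"
  by (auto simp: mono_index_def compositions_def)

section \<open>Iterated deconcatenation\<close>

text \<open>These lists index the terms of the \<open>k\<close>-fold coproduct of
  \<open>mono_qs I\<close>. Empty factors are allowed, since deconcatenation also cuts at both ends
  of \<open>I\<close>.\<close>

definition factorizations :: "nat \<Rightarrow> 'a list \<Rightarrow> 'a list list set" where
  "factorizations k I = {Is. length Is = k \<and> concat Is = I}"

lemma finite_factorizations [simp]: "finite (factorizations k I)"
proof (rule finite_subset)
  show "factorizations k I \<subseteq> {Is. set Is \<subseteq> {J. set J \<subseteq> set I \<and> length J \<le> length I} \<and> length Is = k}"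
    by (auto simp: factorizations_def length_concat intro!: member_le_sum_list)
  show "finite {Is. set Is \<subseteq> {J. set J \<subseteq> set I \<and> length J \<le> length I} \<and> length Is = k}"
    by (intro finite_lists_length_eq finite_lists_length_le) simp
qed

lemma factorizations_subset_tensor_index:
  "I \<in> mono_index \<Longrightarrow> factorizations k I \<subseteq> tensor_index k"
  by (auto simp: factorizations_def tensor_index_def mono_index_iff)

text \<open>Cutting the first factor in two is a bijection from factorizations with a marked cut
  position onto those with one more factor; the inverse joins the first two factors and remembers
  the length of the first. This is the effect of one application of
  \<open>coproduct_first\<close>.\<close>

lemma sum_factorizations_Suc:
  fixes G :: "'a list list \<Rightarrow> 'b::comm_monoid_add"
  shows "(\<Sum>Is\<in>factorizations (Suc k) I. \<Sum>j\<le>length (hd Is). G (take j (hd Is) # drop j (hd Is) # tl Is))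
    = (\<Sum>Is\<in>factorizations (Suc (Suc k)) I. G Is)"
proof -
  have "(\<Sum>Is\<in>factorizations (Suc k) I. \<Sum>j\<le>length (hd Is). G (take j (hd Is) # drop j (hd Is) # tl Is))
    = (\<Sum>(Is, j)\<in>(SIGMA Is:factorizations (Suc k) I. {..length (hd Is)}).
        G (take j (hd Is) # drop j (hd Is) # tl Is))"
    by (rule sum.Sigma) auto
  also have "\<dots> = (\<Sum>Is\<in>factorizations (Suc (Suc k)) I. G Is)"
    by (rule sum.reindex_bij_witness[where
          j = "\<lambda>(Is, j). take j (hd Is) # drop j (hd Is) # tl Is" and
          i = "\<lambda>Is. ((hd Is @ hd (tl Is)) # tl (tl Is), length (hd Is))"])
      (auto simp: factorizations_def length_Suc_conv)
  finally show ?thesis .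
qed

lemma coproduct_mono_qs:
  "I \<in> mono_index \<Longrightarrow>
    coproduct (mono_qs I) = (\<Sum>j\<le>length I. pure_tensor [mono_qs (take j I), mono_qs (drop j I)])"
  unfolding coproduct_def by (rule linear_ext_basis[OF mono_qs_basis(2) mono_qs_basis(1)])

lemma pure_tensor_Cons [simp]:
  "pure_tensor (f # fs) [] = 0"
  "pure_tensor (f # fs) (u # us) = f u * pure_tensor fs us"
  by (simp_all add: pure_tensor_def prod.lessThan_Suc_shift del: prod.lessThan_Suc)

lemma tensor_append2_pure:
  "tensor_append2 (pure_tensor [f, g]) (pure_tensor fs) = pure_tensor (f # g # fs)"
proof
  fix us :: "monom list"
  show "tensor_append2 (pure_tensor [f, g]) (pure_tensor fs) us = pure_tensor (f # g # fs) us"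
  \<comment> \<open>The rule serves only to distinguish lists of length 0, 1 and at least 2. Below
    length 2 both sides vanish.\<close>
  proof (cases us rule: remdups_adj.cases)
    case (3 u v vs)
    then show ?thesis
      by (simp add: tensor_append2_def pure_tensor_def[of "[]"])
  qed (simp_all add: tensor_append2_def)
qed

lemma tensor_append2_sum:
  "tensor_append2 (\<Sum>i\<in>A. S i) T = (\<Sum>i\<in>A. tensor_append2 (S i) T)"
  by (induction A rule: infinite_finite_induct)
    (auto simp: tensor_append2_def fun_eq_iff algebra_simps)

lemma coproduct_first_mono_tensor:
  assumes "Is \<in> tensor_index k" "k \<noteq> 0"
  shows "coproduct_first k (mono_tensor Is) =
    (\<Sum>j\<le>length (hd Is). mono_tensor (take j (hd Is) # drop j (hd Is) # tl Is))"
proof -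
  have "hd Is \<in> mono_index"
    using assms by (cases Is) (auto simp: tensor_index_def)
  moreover have "coproduct_first k (mono_tensor Is) =
      tensor_append2 (coproduct (mono_qs (hd Is))) (mono_tensor (tl Is))"
    unfolding coproduct_first_def
    by (rule linear_ext_basis[OF mono_tensor_basis(2) mono_tensor_basis(1) assms(1)])
  ultimately show ?thesis
    by (simp add: coproduct_mono_qs tensor_append2_sum mono_tensor_def tensor_append2_pure)
qed

text \<open>Each further coproduct splits the first factor only, and this already produces every
  factorization exactly once.\<close>

lemma coproduct_iter_mono_qs:
  assumes "I \<in> mono_index"
  shows "coproduct_iter (Suc k) (mono_qs I) = (\<Sum>Is\<in>factorizations (Suc k) I. mono_tensor Is)"
proof (induction k)
  case 0
  have "factorizations (Suc 0) I = {[I]}"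
    by (auto simp: factorizations_def length_Suc_conv)
  then show ?case by (simp add: mono_tensor_def)
next
  case (Suc k)
  have lin: "linear (coproduct_first (Suc k))"
    unfolding coproduct_first_def by (rule linear_linear_ext[OF mono_tensor_basis(2)])
  have "coproduct_iter (Suc (Suc k)) (mono_qs I) =
      (\<Sum>Is\<in>factorizations (Suc k) I. coproduct_first (Suc k) (mono_tensor Is))"
    by (simp add: Suc linear_sum[OF lin])
  also have "\<dots> = (\<Sum>Is\<in>factorizations (Suc k) I. \<Sum>j\<le>length (hd Is).
      mono_tensor (take j (hd Is) # drop j (hd Is) # tl Is))"
    using factorizations_subset_tensor_index[OF assms]
    by (intro sum.cong coproduct_first_mono_tensor) auto
  also have "\<dots> = (\<Sum>Is\<in>factorizations (Suc (Suc k)) I. mono_tensor Is)"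
    by (rule sum_factorizations_Suc)
  finally show ?case .
qed

lemma hopf_power_mono_qs:
  assumes "1 \<le> a" "I \<in> mono_index"
  shows "hopf_power a (mono_qs I) = (\<Sum>Is\<in>factorizations a I. series_prod_list (map mono_qs Is))"
proof -
  obtain k where a: "a = Suc k" using assms by (cases a) auto
  have lin: "linear (product_iter a)"
    unfolding product_iter_def by (rule linear_linear_ext[OF mono_tensor_basis(2)])
  have "product_iter a (mono_tensor Is) = series_prod_list (map mono_qs Is)"
    if "Is \<in> tensor_index a" for Is
    unfolding product_iter_def
    by (rule linear_ext_basis[OF mono_tensor_basis(2) mono_tensor_basis(1) that])
  then show ?thesis
    using factorizations_subset_tensor_index[OF assms(2), of a]
    by (auto simp: hopf_power_def a coproduct_iter_mono_qs[OF assms(2)] linear_sum[OF lin[unfolded a]]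
      intro!: sum.cong)
qed

section \<open>Fundamental quasisymmetric functions as generating functions of colourings\<close>

text \<open>A term of \<open>mono_qs J\<close>, given by an increasing index sequence
  \<open>js\<close>, is encoded as the word of its variables with multiplicities. Such a word
  assigns one colour to each card of a deck of size \<open>sum_list J\<close>.\<close>

definition blow_up :: "nat list \<Rightarrow> 'c list \<Rightarrow> 'c list" where
  "blow_up J js = concat (map2 replicate J js)"

lemma blow_up_simps [simp]:
  "blow_up [] js = []"
  "blow_up J [] = []"
  "blow_up (i # J) (j # js) = replicate i j @ blow_up J js"
  by (simp_all add: blow_up_def)

lemma length_blow_up: "length js = length J \<Longrightarrow> length (blow_up J js) = sum_list J"
  by (induction js J rule: list_induct2) auto

lemma set_blow_up_subset: "set (blow_up J js) \<subseteq> set js"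
  by (induction J js rule: list_induct2') auto

text \<open>The exponent vector of the product of the variables listed in \<open>f\<close>.\<close>

definition content :: "nat list \<Rightarrow> monom" where
  "content f = (\<Sum>j\<leftarrow>f. Poly_Mapping.single j 1)"

lemma content_blow_up:
  "length js = length J \<Longrightarrow> content (blow_up J js) = monomial js J"
proof (induction js J rule: list_induct2)
  case (Cons j js i J)
  have "(\<Sum>j\<leftarrow>replicate i j. Poly_Mapping.single j 1) = Poly_Mapping.single j i"
    by (induction i) (simp_all flip: single_add)
  then show ?case
    using Cons by (simp add: content_def monomial_def)
qed (simp_all add: content_def monomial_def)

text \<open>Ties between equal colours are broken by the letters. Along a word with distinct letters
  this lets a colour repeat at an ascent and forces it to increase at a descent, as for P-partitions
  of a labelled chain.\<close>

definition colour_less :: "nat \<times> 'a::linorder \<Rightarrow> nat \<times> 'a \<Rightarrow> bool" where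
  "colour_less p q \<longleftrightarrow> fst p < fst q \<or> fst p = fst q \<and> snd p < snd q"

lemma sorted_wrt_zip_replicate:
  "length w = i \<Longrightarrow> sorted_wrt colour_less (zip (replicate i j) w) \<longleftrightarrow> sorted_wrt (<) w"
  by (induction i arbitrary: w) (auto simp: length_Suc_conv colour_less_def in_set_zip zip_replicate1)

text \<open>Within a block the colour is constant, so the letters must increase; between blocks the
  colours increase and the letters do not matter. Distinctness of \<open>w\<close> identifies weak
  with strict sortedness.\<close>

lemma sorted_wrt_zip_blow_up:
  assumes "length js = length J" "sorted_wrt (<) js" "distinct w" "length w = sum_list J"
  shows "sorted_wrt colour_less (zip (blow_up J js) w) \<longleftrightarrow> (\<forall>p\<in>set (cut J w). sorted p)"
  using assms
proof (induction js J arbitrary: w rule: list_induct2)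
  case (Cons j js i J)
  have IH: "sorted_wrt colour_less (zip (blow_up J js) (drop i w)) \<longleftrightarrow>
      (\<forall>p\<in>set (cut J (drop i w)). sorted p)"
    using Cons.prems by (intro Cons.IH) auto
  have "sorted_wrt colour_less (zip (replicate i j) (take i w)) \<longleftrightarrow> sorted (take i w)"
    using Cons.prems by (subst sorted_wrt_zip_replicate) (auto simp: strict_sorted_iff)
  moreover have "colour_less p q"
    if "p \<in> set (zip (replicate i j) (take i w))" "q \<in> set (zip (blow_up J js) (drop i w))" for p q
  proof -
    have fst_in: "fst r \<in> set f" if "r \<in> set (zip f v)" for r and f :: "nat list" and v :: "'a list"
      using that set_zip_leftD[of "fst r" "snd r" f v] by simp
    have "fst p = j" using fst_in[OF that(1)] by (auto split: if_splits)
    moreover have "fst q \<in> set js" using fst_in[OF that(2)] set_blow_up_subset[of J js] by blast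
    ultimately show ?thesis using Cons.prems by (auto simp: colour_less_def)
  qed
  ultimately show ?case
    using IH by (auto simp: zip_append1 sorted_wrt_append)
qed simp

text \<open>Positive multiplicities and distinct colours make the runs of the word maximal, so the
  first run can be read off and removed.\<close>

lemma blow_up_inj:
  assumes "\<forall>i\<in>set J. 0 < i" "\<forall>i\<in>set K. 0 < i" "length js = length J" "length ks = length K"
    and "distinct js" "distinct ks" "blow_up J js = blow_up K ks"
  shows "J = K \<and> js = ks"
  using assms
proof (induction J arbitrary: js K ks)
  case Nil
  then show ?case by (cases K; cases ks) auto
next
  case (Cons i J)
  obtain j js' where js: "js = j # js'" using Cons.prems by (cases js) auto
  from Cons.prems js obtain k ks' l K' where ks: "ks = k # ks'" "K = l # K'"
    by (cases K; cases ks) auto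
  obtain i' l' where i: "i = Suc i'" "l = Suc l'"
    using Cons.prems ks by (cases i; cases l) auto
  have eq: "replicate i j @ blow_up J js' = replicate l k @ blow_up K' ks'"
    using Cons.prems js ks by simp
  have jk: "k = j" using eq unfolding i by simp
  have notin: "j \<notin> set (blow_up J js')" "j \<notin> set (blow_up K' ks')"
    using Cons.prems(5,6) set_blow_up_subset[of J js'] set_blow_up_subset[of K' ks']
    unfolding js ks jk by auto
  \<comment> \<open>The first run is isolated by its colour, which does not recur in the rest of the
    word.\<close>
  have run: "takeWhile (\<lambda>x. x = j) (replicate i j @ f) = replicate i j"
      "dropWhile (\<lambda>x. x = j) (replicate i j @ f) = f" if "j \<notin> set f" for i and f :: "'a list"
  proof -
    have f: "takeWhile (\<lambda>x. x = j) f = [] \<and> dropWhile (\<lambda>x. x = j) f = f"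
      using that by (cases f) auto
    show "takeWhile (\<lambda>x. x = j) (replicate i j @ f) = replicate i j"
      by (induction i) (simp_all add: f)
    show "dropWhile (\<lambda>x. x = j) (replicate i j @ f) = f"
      by (induction i) (simp_all add: f)
  qed
  have "replicate i j = replicate l j" "blow_up J js' = blow_up K' ks'"
    using arg_cong[OF eq, of "takeWhile (\<lambda>x. x = j)"] arg_cong[OF eq, of "dropWhile (\<lambda>x. x = j)"]
    unfolding jk run[OF notin(1)] run[OF notin(2)] by simp_all
  moreover from this(1) have "i = l"
    by (metis length_replicate)
  ultimately show ?case
    using Cons.IH[of K' js' ks'] Cons.prems js ks jk by simp
qed

text \<open>Run-length encoding: a new first letter, being at most all the others, either starts a
  run of length 1 or lengthens the first run.\<close>

lemma blow_up_surj:
  assumes "sorted f"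
  shows "\<exists>J js. (\<forall>i\<in>set J. 0 < i) \<and> length js = length J \<and> sorted_wrt (<) js \<and>
    set js = set f \<and> blow_up J js = f"
  using assms
proof (induction f)
  case Nil
  then show ?case by (intro exI[of _ "[]"]) simp
next
  case (Cons x f)
  then obtain J js where IH: "\<forall>i\<in>set J. 0 < i" "length js = length J" "sorted_wrt (<) js"
    "set js = set f" "blow_up J js = f" by auto
  show ?case
  proof (cases "x \<in> set f")
    case False
    then have "sorted_wrt (<) (x # js)"
      using Cons.prems IH(3,4) by (auto intro: le_neq_trans)
    then show ?thesis
      using IH by (intro exI[of _ "1 # J"] exI[of _ "x # js"]) auto
  next
    case True
    then obtain j js' where js: "js = j # js'" using IH by (cases js) auto
    then obtain i J' where J: "J = i # J'" using IH by (cases J) auto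
    have "j \<in> set f" "x \<in> insert j (set js')"
      using True unfolding IH(4)[symmetric] js by simp_all
    moreover have "x \<le> j"
      using Cons.prems \<open>j \<in> set f\<close> by simp
    ultimately have "x = j"
      using IH(3) js by auto
    then show ?thesis
      using IH js J True by (intro exI[of _ "Suc i # J'"] exI[of _ js]) auto
  qed
qed

lemma sorted_fst_if_sorted_wrt_colour_less:
  assumes "sorted_wrt colour_less (zip f w)" "length f = length w"
  shows "sorted f"
proof -
  have "sorted_wrt (\<lambda>p q. fst p \<le> fst q) (zip f w)"
    by (rule sorted_wrt_mono_rel[OF _ assms(1)]) (auto simp: colour_less_def)
  then have "sorted (map fst (zip f w))"
    by (simp add: sorted_wrt_map)
  then show ?thesis using assms(2) by simp
qed

section \<open>Counting the colourings of a deck\<close>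

text \<open>The value 0 off the deck makes a colouring determined by its values on the letters,
  which permits counting, and lets colourings of disjoint words be glued by addition.\<close>

definition colourings :: "'a::linorder list \<Rightarrow> ('a \<Rightarrow> nat) set" where
  "colourings w = {g. (\<forall>x. x \<notin> set w \<longrightarrow> g x = 0) \<and> sorted_wrt (\<lambda>x y. colour_less (g x, x) (g y, y)) w}"

definition weight :: "'a set \<Rightarrow> ('a \<Rightarrow> nat) \<Rightarrow> monom" where
  "weight A g = (\<Sum>x\<in>A. Poly_Mapping.single (g x) 1)"

text \<open>As all parts of \<open>J\<close> are positive, every index in \<open>js\<close> is a
  variable that occurs in \<open>m\<close>.\<close>

lemma finite_mono_qs_support:
  assumes "J \<in> mono_index"
  shows "finite {js. length js = length J \<and> sorted_wrt (<) js \<and> monomial js J = m}"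
proof (rule finite_subset)
  show "finite {js. set js \<subseteq> Poly_Mapping.keys m \<and> length js = length J}"
    by (rule finite_lists_length_eq) simp
  have "js ! k \<in> Poly_Mapping.keys (monomial js J)"
    if "length js = length J" "sorted_wrt (<) js" "k < length js" for js k
    using lookup_monomial_nth[of js J k] that assms
    by (auto simp: strict_sorted_iff in_keys_iff mono_index_iff)
  then show "{js. length js = length J \<and> sorted_wrt (<) js \<and> monomial js J = m}
      \<subseteq> {js. set js \<subseteq> Poly_Mapping.keys m \<and> length js = length J}"
    by (auto simp: in_set_conv_nth)
qed

definition colourings_of_weight :: "'a::linorder list \<Rightarrow> monom \<Rightarrow> ('a \<Rightarrow> nat) set" where
  "colourings_of_weight w m = {g \<in> colourings w. weight (set w) g = m}"

lemma sorted_wrt_colour_less_zip: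
  "sorted_wrt colour_less (zip (map g w) w) \<longleftrightarrow> sorted_wrt (\<lambda>x y. colour_less (g x, x) (g y, y)) w"
  by (simp add: zip_map1 zip_same_conv_map sorted_wrt_map)

lemma content_map:
  "distinct w \<Longrightarrow> content (map g w) = weight (set w) g"
  by (simp add: content_def weight_def sum.distinct_set_conv_list o_def)

lemma bij_betw_colourings_of_weight:
  assumes "distinct w"
  shows "bij_betw (\<lambda>g. map g w) (colourings_of_weight w m)
    {f. length f = length w \<and> sorted_wrt colour_less (zip f w) \<and> content f = m}"
proof (rule bij_betwI')
  show "map g w = map h w \<longleftrightarrow> g = h"
    if "g \<in> colourings_of_weight w m" "h \<in> colourings_of_weight w m" for g h
  proof
    assume "map g w = map h w"
    then have "g x = h x" for x
      using that by (cases "x \<in> set w") (auto simp: colourings_of_weight_def colourings_def)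
    then show "g = h" by blast
  qed simp
  show "map g w \<in> {f. length f = length w \<and> sorted_wrt colour_less (zip f w) \<and> content f = m}"
    if "g \<in> colourings_of_weight w m" for g
    using that assms
    by (simp add: colourings_of_weight_def colourings_def sorted_wrt_colour_less_zip content_map)
  fix f assume f: "f \<in> {f. length f = length w \<and> sorted_wrt colour_less (zip f w) \<and> content f = m}"
  \<comment> \<open>The default 0 is the value that \<open>colourings\<close> prescribes off the
    deck.\<close>
  define g where "g x = (case map_of (zip w f) x of None \<Rightarrow> 0 | Some c \<Rightarrow> c)" for x
  have "map g w = f"
  proof (rule nth_equalityI)
    show "map g w ! k = f ! k" if "k < length (map g w)" for k
      using that f assms by (simp add: g_def map_of_zip_nth)
  qed (use f in simp)
  moreover have "g x = 0" if "x \<notin> set w" for x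
    using that f by (auto simp: g_def split: option.splits dest!: map_of_SomeD set_zip_leftD)
  ultimately show "\<exists>g\<in>colourings_of_weight w m. f = map g w"
    using f assms
    by (intro bexI[of _ g])
      (auto simp: colourings_of_weight_def colourings_def simp flip: sorted_wrt_colour_less_zip content_map)
qed

text \<open>By run-length encoding, a sorted colour word comes from exactly one pair
  \<open>(J, js)\<close>, and its compatibility with \<open>w\<close> says precisely that
  \<open>J\<close> cuts \<open>w\<close> into increasing blocks. So the terms of all the
  \<open>mono_qs J\<close> in the expansion of \<open>fund_qs (Des w)\<close> are gathered in one
  set of words.\<close>

lemma bij_betw_blow_up:
  assumes "distinct w"
  shows "bij_betw (\<lambda>(J, js). blow_up J js)
    (SIGMA J:sorted_cuts w. {js. length js = length J \<and> sorted_wrt (<) js \<and> monomial js J = m})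
    {f. length f = length w \<and> sorted_wrt colour_less (zip f w) \<and> content f = m}"
    (is "bij_betw ?h ?P ?Q")
proof (rule bij_betwI')
  show "?h p = ?h q \<longleftrightarrow> p = q" if "p \<in> ?P" "q \<in> ?P" for p q
  proof -
    obtain J js K ks where p: "p = (J, js)" "q = (K, ks)" by fastforce
    show ?thesis
      using that blow_up_inj[of J K js ks] unfolding p
      by (auto simp: sorted_cuts_def compositions_def strict_sorted_iff)
  qed
  show "?h p \<in> ?Q" if "p \<in> ?P" for p
  proof -
    obtain J js where p: "p = (J, js)" by fastforce
    have J: "length js = length J" "sorted_wrt (<) js" "sum_list J = length w"
        "\<forall>p\<in>set (cut J w). sorted p" "monomial js J = m"
      using that by (auto simp: p sorted_cuts_def compositions_def)
    then show ?thesis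
      using sorted_wrt_zip_blow_up[OF J(1,2) assms] by (simp add: p length_blow_up content_blow_up)
  qed
  fix f assume f: "f \<in> ?Q"
  then have "sorted f"
    using sorted_fst_if_sorted_wrt_colour_less[of f w] by simp
  then obtain J js where J: "\<forall>i\<in>set J. 0 < i" "length js = length J" "sorted_wrt (<) js" "blow_up J js = f"
    using blow_up_surj by blast
  have "sum_list J = length w"
    using f J(4) length_blow_up[OF J(2)] by simp
  then have "(J, js) \<in> ?P"
    using f J assms sorted_wrt_zip_blow_up[OF J(2,3) assms] content_blow_up[OF J(2)]
    by (auto simp: sorted_cuts_def compositions_def)
  moreover have "f = ?h (J, js)" using J(4) by simp
  ultimately show "\<exists>p\<in>?P. f = ?h p" by (rule bexI[rotated])
qed

lemma sorted_cuts_subset_mono_index: "sorted_cuts w \<subseteq> mono_index"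
  by (auto simp: sorted_cuts_def mono_index_def)

text \<open>The two bijections with colour words turn the sum of the counts in
  \<open>mono_qs J\<close> over the sorted cuts into a single count of colourings. Finiteness passes
  along the same bijections.\<close>

lemma
  assumes "distinct w"
  shows finite_colourings_of_weight: "finite (colourings_of_weight w m)"
    and fund_qs_Des_eq_card: "fund_qs (Des w) m = real (card (colourings_of_weight w m))"
proof -
  let ?P = "SIGMA J:sorted_cuts w. {js. length js = length J \<and> sorted_wrt (<) js \<and> monomial js J = m}"
  have fin: "finite {js. length js = length J \<and> sorted_wrt (<) js \<and> monomial js J = m}"
    if "J \<in> sorted_cuts w" for J
    using that sorted_cuts_subset_mono_index by (blast intro: finite_mono_qs_support)
  have finP: "finite ?P" using fin by (intro finite_SigmaI) auto
  show "finite (colourings_of_weight w m)"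
    unfolding bij_betw_finite[OF bij_betw_colourings_of_weight[OF assms]]
      bij_betw_finite[OF bij_betw_blow_up[OF assms], symmetric] by (rule finP)
  have "fund_qs (Des w) m = real (card ?P)"
    using fin by (simp add: fund_qs_Des sum_fun_apply mono_qs_def card_SigmaI)
  then show "fund_qs (Des w) m = real (card (colourings_of_weight w m))"
    unfolding bij_betw_same_card[OF bij_betw_blow_up[OF assms]]
      bij_betw_same_card[OF bij_betw_colourings_of_weight[OF assms]] .
qed

section \<open>The product of fundamental quasisymmetric functions\<close>

text \<open>This is the merge step of merge sort: of the two heads, the one that precedes the other
  goes first, and by transitivity it precedes all remaining letters of both words.\<close>

lemma ex_sorted_wrt_shuffle:
  assumes "transp r" "sorted_wrt r u" "sorted_wrt r v" "\<forall>x\<in>set u. \<forall>y\<in>set v. r x y \<or> r y x"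
  shows "\<exists>w\<in>shuffles u v. sorted_wrt r w"
  using assms(2-)
proof (induction u v rule: shuffles.induct)
  case (3 x u y v)
  have tr: "r a c" if "r a b" "r b c" for a b c
    using that assms(1) by (auto dest: transpD)
  show ?case
  proof (cases "r x y")
    case True
    then obtain w where w: "w \<in> shuffles u (y # v)" "sorted_wrt r w"
      using "3.IH"(1) "3.prems" by auto
    have "r x z" if "z \<in> set w" for z
    proof -
      from that consider "z \<in> set u" | "z = y" | "z \<in> set v"
        using set_shuffles[OF w(1)] by auto
      then show ?thesis
        using "3.prems"(1,2) True tr[OF True, of z] by cases simp_all
    qed
    then have "sorted_wrt r (x # w)" using w by simp
    moreover have "x # w \<in> shuffles (x # u) (y # v)" using w by simp
    ultimately show ?thesis by blast
  next
    case False
    then have yx: "r y x" using "3.prems" by auto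
    then obtain w where w: "w \<in> shuffles (x # u) v" "sorted_wrt r w"
      using "3.IH"(2) "3.prems" by auto
    have "r y z" if "z \<in> set w" for z
    proof -
      from that consider "z \<in> set v" | "z = x" | "z \<in> set u"
        using set_shuffles[OF w(1)] by auto
      then show ?thesis
        using "3.prems"(1,2) yx tr[OF yx, of z] by cases simp_all
    qed
    then have "sorted_wrt r (y # w)" using w by simp
    moreover have "y # w \<in> shuffles (x # u) (y # v)" using w by simp
    ultimately show ?thesis by blast
  qed
qed auto

text \<open>If the heads differed, each would occur behind the other and so precede it, against
  asymmetry. As the relation is irreflexive, the common head does not recur, so the tails have equal
  sets as well.\<close>

lemma sorted_wrt_asymp_unique:
  assumes "asymp r" "sorted_wrt r u" "sorted_wrt r v" "set u = set v"
  shows "u = v"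
  using assms(2-)
proof (induction u arbitrary: v)
  case (Cons x u)
  then obtain y v' where v: "v = y # v'" by (cases v) auto
  have as: "\<not> r b a" if "r a b" for a b
    using asympD[OF assms(1) that] .
  have xu: "r x z" if "z \<in> set u" for z
    using that Cons.prems(1) by simp
  have yv: "r y z" if "z \<in> set v'" for z
    using that Cons.prems(2) v by simp
  have eq: "insert x (set u) = insert y (set v')"
    using Cons.prems(3) v by simp
  have xy: "x = y"
  proof (rule ccontr)
    assume neq: "x \<noteq> y"
    have "y \<in> insert x (set u)" "x \<in> insert y (set v')"
      by (simp add: eq, simp flip: eq)
    then have "y \<in> set u" "x \<in> set v'" using neq by simp_all
    then show False using as[OF xu] yv by blast
  qed
  have irr: "\<not> r x x" using as by blast
  then have "x \<notin> set u" "x \<notin> set v'"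
    using xu yv unfolding xy by metis+
  then have "set u = set v'"
    using eq unfolding xy by (simp add: insert_ident)
  then show ?case
    using Cons.IH[of v'] Cons.prems(1,2) v xy by simp
qed simp

lemma asymp_colour_less: "asymp (\<lambda>x y. colour_less (g x, x) (g y, y))"
  by (rule asympI) (auto simp: colour_less_def)

definition restrict0 :: "'a set \<Rightarrow> ('a \<Rightarrow> nat) \<Rightarrow> 'a \<Rightarrow> nat" where
  "restrict0 A g x = (if x \<in> A then g x else 0)"

lemma weight_cong: "(\<And>x. x \<in> A \<Longrightarrow> g x = h x) \<Longrightarrow> weight A g = weight A h"
  by (simp add: weight_def)

lemma weight_Un_disjoint:
  "finite A \<Longrightarrow> finite B \<Longrightarrow> A \<inter> B = {} \<Longrightarrow> weight (A \<union> B) g = weight A g + weight B g"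
  by (simp add: weight_def sum.union_disjoint)

text \<open>The lexicographic order of colour and letter is asymmetric, so one colouring arranges a
  set of letters in at most one way. This makes the union over shuffles disjoint.\<close>

lemma colourings_disjoint:
  assumes "set w = set w'" "g \<in> colourings w" "g \<in> colourings w'"
  shows "w = w'"
  using sorted_wrt_asymp_unique[OF asymp_colour_less, of g w w'] assms
  by (simp add: colourings_def)

text \<open>A colouring that sorts a shuffle also sorts its subwords \<open>u\<close> and
  \<open>v\<close>. Conversely, a colouring that sorts both words allows them to be merged into a
  sorted shuffle.\<close>

lemma Un_colourings_shuffles:
  assumes "distinct (u @ v)"
  shows "(\<Union>w\<in>shuffles u v. colourings w) =
    {g. restrict0 (set u) g \<in> colourings u \<and> restrict0 (set v) g \<in> colourings v \<and>
        (\<forall>x. x \<notin> set u \<union> set v \<longrightarrow> g x = 0)}" (is "?L = ?R")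
proof -
  have dis: "set u \<inter> set v = {}" using assms by simp
  have restr: "restrict0 (set u) g \<in> colourings u \<longleftrightarrow>
      sorted_wrt (\<lambda>x y. colour_less (g x, x) (g y, y)) u" for u :: "'a list" and g
  proof -
    have "sorted_wrt (\<lambda>x y. colour_less (restrict0 (set u) g x, x) (restrict0 (set u) g y, y)) u \<longleftrightarrow>
      sorted_wrt (\<lambda>x y. colour_less (g x, x) (g y, y)) u"
      by (intro iffI; erule sorted_wrt_mono_rel[rotated]) (simp_all add: restrict0_def)
    then show ?thesis by (simp add: colourings_def restrict0_def)
  qed
  show ?thesis
  proof (intro equalityI subsetI)
    fix g assume "g \<in> ?L"
    then obtain w where w: "w \<in> shuffles u v" "g \<in> colourings w" by blast
    have srt: "sorted_wrt (\<lambda>x y. colour_less (g x, x) (g y, y)) (filter P w)" for P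
      using w(2) by (auto simp: colourings_def intro: sorted_wrt_filter)
    have "sorted_wrt (\<lambda>x y. colour_less (g x, x) (g y, y)) u"
      "sorted_wrt (\<lambda>x y. colour_less (g x, x) (g y, y)) v"
      using srt[of "\<lambda>x. x \<in> set u"] srt[of "\<lambda>x. x \<notin> set u"]
      unfolding filter_shuffles_disjoint1[OF dis w(1)] .
    moreover have "g x = 0" if "x \<notin> set u \<union> set v" for x
      using that w set_shuffles[OF w(1)] by (simp add: colourings_def)
    ultimately show "g \<in> ?R" by (simp add: restr)
  next
    fix g assume g: "g \<in> ?R"
    have "\<exists>w\<in>shuffles u v. sorted_wrt (\<lambda>x y. colour_less (g x, x) (g y, y)) w"
    proof (rule ex_sorted_wrt_shuffle)
      show "transp (\<lambda>x y. colour_less (g x, x) (g y, y))"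
        by (rule transpI) (auto simp: colour_less_def)
      \<comment> \<open>Disjointness of the words keeps their letters comparable even when the
        colours agree.\<close>
      have "x < y \<or> y < x" if "x \<in> set u" "y \<in> set v" for x y
        using that dis by (metis disjoint_iff linorder_less_linear)
      then show "\<forall>x\<in>set u. \<forall>y\<in>set v. colour_less (g x, x) (g y, y) \<or> colour_less (g y, y) (g x, x)"
        by (auto simp: colour_less_def)
    qed (use g in \<open>simp_all add: restr\<close>)
    then obtain w where w: "w \<in> shuffles u v" "sorted_wrt (\<lambda>x y. colour_less (g x, x) (g y, y)) w"
      by blast
    then have "g \<in> colourings w"
      using g set_shuffles[OF w(1)] by (simp add: colourings_def)
    then show "g \<in> ?L" using w(1) by blast
  qed
qed

text \<open>Colourings with disjoint supports are glued by pointwise addition and recovered by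
  restriction; their weights, as exponent vectors, add up to \<open>m\<close>.\<close>

lemma bij_betw_colourings_product:
  assumes "distinct (u @ v)"
  shows "bij_betw (\<lambda>((k, l), (g, h)) x. g x + h x)
    (SIGMA (k, l):{(k, l). k + l = m}. colourings_of_weight u k \<times> colourings_of_weight v l)
    (\<Union>w\<in>shuffles u v. colourings_of_weight w m)"
    (is "bij_betw ?f ?A ?B")
proof -
  have dis: "set u \<inter> set v = {}" using assms by simp
  have wt: "weight (set w) g = weight (set u) g + weight (set v) g"
    if "w \<in> shuffles u v" for w g
    using that dis by (simp add: set_shuffles weight_Un_disjoint)
  have B: "?B = {g \<in> \<Union>w\<in>shuffles u v. colourings w. weight (set u) g + weight (set v) g = m}"
    using wt by (auto simp: colourings_of_weight_def)
  let ?h = "\<lambda>g. ((weight (set u) g, weight (set v) g), (restrict0 (set u) g, restrict0 (set v) g))"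
  show ?thesis
  proof (rule bij_betw_byWitness[where f' = ?h])
    show "\<forall>p\<in>?A. ?h (?f p) = p"
    proof
      fix p assume "p \<in> ?A"
      then obtain k l g h where p: "p = ((k, l), (g, h))" and
        gh: "g \<in> colourings_of_weight u k" "h \<in> colourings_of_weight v l"
        by auto
      have g0: "g x = 0" if "x \<notin> set u" for x
        using gh(1) that by (simp add: colourings_of_weight_def colourings_def)
      have h0: "h x = 0" if "x \<notin> set v" for x
        using gh(2) that by (simp add: colourings_of_weight_def colourings_def)
      have "restrict0 (set u) (\<lambda>x. g x + h x) = g" "restrict0 (set v) (\<lambda>x. g x + h x) = h"
        using g0 h0 dis by (auto simp: restrict0_def fun_eq_iff)
      moreover have "weight (set u) (\<lambda>x. g x + h x) = weight (set u) g"
        using h0 dis by (intro weight_cong) auto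
      moreover have "weight (set v) (\<lambda>x. g x + h x) = weight (set v) h"
        using g0 dis by (intro weight_cong) auto
      ultimately show "?h (?f p) = p"
        using gh by (simp add: p colourings_of_weight_def)
    qed
    show eq: "\<forall>g\<in>?B. ?f (?h g) = g"
      using dis unfolding B Un_colourings_shuffles[OF assms]
      by (auto simp: restrict0_def fun_eq_iff)
    show "?h ` ?B \<subseteq> ?A"
      unfolding B Un_colourings_shuffles[OF assms]
      by (auto simp: colourings_of_weight_def restrict0_def intro: weight_cong)
    show "?f ` ?A \<subseteq> ?B"
    proof
      fix f assume "f \<in> ?f ` ?A"
      then obtain k l g h where f: "f = (\<lambda>x. g x + h x)" and kl: "k + l = m" and
        gh: "g \<in> colourings_of_weight u k" "h \<in> colourings_of_weight v l"
        by auto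
      have g0: "g x = 0" if "x \<notin> set u" for x
        using gh(1) that by (simp add: colourings_of_weight_def colourings_def)
      have h0: "h x = 0" if "x \<notin> set v" for x
        using gh(2) that by (simp add: colourings_of_weight_def colourings_def)
      have "restrict0 (set u) f = g" "restrict0 (set v) f = h"
        using g0 h0 dis by (auto simp: restrict0_def fun_eq_iff f)
      moreover have "weight (set u) f = weight (set u) g"
        using h0 dis unfolding f by (intro weight_cong) auto
      moreover have "weight (set v) f = weight (set v) h"
        using g0 dis unfolding f by (intro weight_cong) auto
      moreover have "\<forall>x. x \<notin> set u \<union> set v \<longrightarrow> f x = 0"
        using g0 h0 by (simp add: f)
      ultimately show "f \<in> ?B"
        using gh kl unfolding B Un_colourings_shuffles[OF assms]
        by (simp add: colourings_of_weight_def)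
    qed
  qed
qed

text \<open>At each monomial \<open>m\<close>, the left-hand side counts pairs of colourings whose
  weights add up to \<open>m\<close>. Gluing turns them into colourings of shuffles, and no
  colouring belongs to two different shuffles.\<close>

lemma fund_qs_product:
  assumes "distinct (u @ v)"
  shows "series_mult (fund_qs (Des u)) (fund_qs (Des v)) = (\<Sum>w\<in>shuffles u v. fund_qs (Des w))"
proof
  fix m
  have uv: "distinct u" "distinct v" using assms by auto
  have dw: "distinct w" if "w \<in> shuffles u v" for w
    using distinct_disjoint_shuffles[of u v w] that assms by simp
  have "series_mult (fund_qs (Des u)) (fund_qs (Des v)) m =
      (\<Sum>(k, l)\<in>{(k, l). k + l = m}. real (card (colourings_of_weight u k \<times> colourings_of_weight v l)))"
    by (simp add: series_mult_def fund_qs_Des_eq_card uv card_cartesian_product)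
  also have "\<dots> = real (card (SIGMA (k, l):{(k, l). k + l = m}.
      colourings_of_weight u k \<times> colourings_of_weight v l))"
    using finite_monom_splits[of m] finite_colourings_of_weight uv
    by (subst card_SigmaI) (auto simp: case_prod_beta)
  also have "\<dots> = real (card (\<Union>w\<in>shuffles u v. colourings_of_weight w m))"
    by (simp add: bij_betw_same_card[OF bij_betw_colourings_product[OF assms]])
  also have "\<dots> = (\<Sum>w\<in>shuffles u v. real (card (colourings_of_weight w m)))"
  proof -
    have "colourings_of_weight w m \<inter> colourings_of_weight w' m = {}"
      if "w \<in> shuffles u v" "w' \<in> shuffles u v" "w \<noteq> w'" for w w'
      using that colourings_disjoint[of w w'] set_shuffles[of w u v] set_shuffles[of w' u v]
      by (auto simp: colourings_of_weight_def)
    then show ?thesis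
      by (subst card_UN_disjoint) (auto simp: finite_colourings_of_weight dw)
  qed
  also have "\<dots> = (\<Sum>w\<in>shuffles u v. fund_qs (Des w)) m"
    by (simp add: sum_fun_apply fund_qs_Des_eq_card dw)
  finally show "series_mult (fund_qs (Des u)) (fund_qs (Des v)) m = (\<Sum>w\<in>shuffles u v. fund_qs (Des w)) m" .
qed

lemma series_mult_sum_left: "series_mult (\<Sum>i\<in>A. f i) g = (\<Sum>i\<in>A. series_mult (f i) g)"
proof
  fix m
  have "series_mult (\<Sum>i\<in>A. f i) g m = (\<Sum>p\<in>{(u, v). u + v = m}. \<Sum>i\<in>A. f i (fst p) * g (snd p))"
    by (simp add: series_mult_def sum_fun_apply sum_distrib_right case_prod_beta)
  also have "\<dots> = (\<Sum>i\<in>A. \<Sum>p\<in>{(u, v). u + v = m}. f i (fst p) * g (snd p))"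
    by (rule sum.swap)
  finally show "series_mult (\<Sum>i\<in>A. f i) g m = (\<Sum>i\<in>A. series_mult (f i) g) m"
    by (simp add: series_mult_def sum_fun_apply case_prod_beta)
qed

lemma series_mult_sum_right: "series_mult f (\<Sum>i\<in>A. g i) = (\<Sum>i\<in>A. series_mult f (g i))"
proof
  fix m
  have "series_mult f (\<Sum>i\<in>A. g i) m = (\<Sum>p\<in>{(u, v). u + v = m}. \<Sum>i\<in>A. f (fst p) * g i (snd p))"
    by (simp add: series_mult_def sum_fun_apply sum_distrib_left case_prod_beta)
  also have "\<dots> = (\<Sum>i\<in>A. \<Sum>p\<in>{(u, v). u + v = m}. f (fst p) * g i (snd p))"
    by (rule sum.swap)
  finally show "series_mult f (\<Sum>i\<in>A. g i) m = (\<Sum>i\<in>A. series_mult f (g i)) m"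
    by (simp add: series_mult_def sum_fun_apply case_prod_beta)
qed

lemma series_prod_list_simps [simp]:
  "series_prod_list [] = series_one"
  "series_prod_list (f # fs) = series_mult f (series_prod_list fs)"
  by (simp_all add: series_prod_list_def)

section \<open>Interleavings of several piles and shuffle probabilities\<close>

lemma finite_interleavings [simp]: "finite (interleavings ps)"
  by (induction ps) auto

lemma mset_interleavings: "w \<in> interleavings ps \<Longrightarrow> mset w = mset (concat ps)"
  by (induction ps arbitrary: w) (auto dest: mset_shuffles)

lemma set_interleavings: "w \<in> interleavings ps \<Longrightarrow> set w = set (concat ps)"
  using mset_interleavings mset_eq_setD by blast

text \<open>Deleting the letters of \<open>p\<close> from \<open>w\<close> leaves the word that
  \<open>p\<close> was shuffled with. Hence the union that defines \<open>interleavings\<close> is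
  disjoint.\<close>

lemma shuffles_interleavings_disjoint:
  assumes "distinct (p @ concat ps)" "v \<in> interleavings ps" "v' \<in> interleavings ps"
    and "w \<in> shuffles p v" "w \<in> shuffles p v'"
  shows "v = v'"
proof -
  have "set p \<inter> set v = {}" "set p \<inter> set v' = {}"
    using assms(1) set_interleavings[OF assms(2)] set_interleavings[OF assms(3)] by auto
  then show ?thesis
    using filter_shuffles_disjoint1(2)[OF _ assms(4)] filter_shuffles_disjoint1(2)[OF _ assms(5)] by simp
qed

lemma sum_interleavings_Cons:
  assumes "distinct (p @ concat ps)"
  shows "(\<Sum>w\<in>interleavings (p # ps). G w) = (\<Sum>v\<in>interleavings ps. \<Sum>w\<in>shuffles p v. G w)"
  using shuffles_interleavings_disjoint[OF assms]
  by (simp, subst sum.UNION_disjoint) auto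

lemma fund_qs_Nil: "fund_qs [] = series_one"
proof -
  have "{J. J \<in> compositions 0 \<and> refines J []} = {[]}"
    by (auto simp: compositions_def refines_def neq_Nil_conv)
  moreover have "mono_qs [] = series_one"
  proof
    fix m
    have "{js. length js = length [] \<and> sorted_wrt (<) js \<and> monomial js [] = m} =
        (if m = 0 then {[]} else {})"
      by (auto simp: monomial_def)
    then show "mono_qs [] m = series_one m"
      by (simp add: mono_qs_def series_one_def)
  qed
  ultimately show ?thesis by (simp add: fund_qs_def)
qed

lemma series_prod_list_fund_qs:
  assumes "distinct (concat ps)"
  shows "series_prod_list (map (\<lambda>p. fund_qs (Des p)) ps) = (\<Sum>w\<in>interleavings ps. fund_qs (Des w))"
  using assms
proof (induction ps)
  case Nil
  have "Des ([] :: 'a list) = []"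
    by (rule is_descent_composition_unique) (simp add: is_descent_composition_def compositions_def)
  then show ?case by (simp add: fund_qs_Nil)
next
  case (Cons p ps)
  have "distinct (p @ v)" if "v \<in> interleavings ps" for v
    using that Cons.prems set_interleavings[OF that] mset_eq_imp_distinct_iff[OF mset_interleavings[OF that]]
    by auto
  then show ?case
    using Cons by (simp add: series_mult_sum_right fund_qs_product sum_interleavings_Cons del: interleavings.simps)
qed

lemma concat_and_lengths_of_cut:
  "sum_list is = length w \<Longrightarrow> concat (cut is w) = w \<and> map length (cut is w) = is"
  by (induction "is" arbitrary: w) auto

lemma multinomial_Cons: "multinomial (i # is) = real ((i + sum_list is) choose i) * multinomial is"
  by (simp add: multinomial_def binomial_fact)

text \<open>The number of shuffles of a pile into an interleaving of the others is a binomial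
  coefficient that depends only on the lengths; these coefficients multiply to the multinomial
  coefficient.\<close>

lemma card_interleavings:
  assumes "distinct (concat ps)"
  shows "real (card (interleavings ps)) = multinomial (map length ps)"
  using assms
proof (induction ps)
  case (Cons p ps)
  have "card (shuffles p v) = (length p + sum_list (map length ps)) choose length p"
    if "v \<in> interleavings ps" for v
  proof -
    have "length v = sum_list (map length ps)"
      using mset_interleavings[OF that] by (metis length_concat size_mset)
    moreover have "set p \<inter> set v = {}"
      using Cons.prems set_interleavings[OF that] by auto
    ultimately show ?thesis by (simp add: card_disjoint_shuffles)
  qed
  then have "card (interleavings (p # ps)) =
      card (interleavings ps) * ((length p + sum_list (map length ps)) choose length p)"
    using sum_interleavings_Cons[of p ps "\<lambda>_. 1::nat"] Cons.prems by (simp del: interleavings.simps)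
  then show ?case
    using Cons by (simp add: multinomial_Cons del: interleavings.simps)
qed (simp add: multinomial_def)

text \<open>The multinomial weight of a cut cancels against the number of its interleavings, so each
  cut that can produce \<open>w'\<close> contributes the same amount.\<close>

lemma riffle_prob_distinct:
  assumes "distinct w"
  shows "riffle_prob a w w' = (\<Sum>is | length is = a \<and> sum_list is = length w.
    of_bool (w' \<in> interleavings (cut is w)) / real a ^ length w)"
  unfolding riffle_prob_def
proof (rule sum.cong)
  fix "is" assume "is \<in> {is. length is = a \<and> sum_list is = length w}"
  then have c: "concat (cut is w) = w" "map length (cut is w) = is"
    using concat_and_lengths_of_cut by blast+
  have "real (card (interleavings (cut is w))) = multinomial is"
    using card_interleavings[of "cut is w"] c assms by simp
  moreover have "multinomial is \<noteq> 0"
    by (simp add: multinomial_def prod_list_zero_iff image_iff)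
  ultimately show "multinomial is / real a ^ length w *
      (of_bool (w' \<in> interleavings (cut is w)) / real (card (interleavings (cut is w)))) =
      of_bool (w' \<in> interleavings (cut is w)) / real a ^ length w"
    by simp
qed simp

section \<open>Deconcatenating compositions and cutting the deck\<close>

text \<open>Cutting by a concatenation means cutting into piles whose sizes are the block sums and
  then cutting each pile by its own block. Empty blocks correspond to empty piles.\<close>

lemma concat_in_sorted_cuts_iff:
  "concat Is \<in> sorted_cuts w \<longleftrightarrow>
    sum_list (map sum_list Is) = length w \<and> list_all2 (\<lambda>I p. I \<in> sorted_cuts p) Is (cut (map sum_list Is) w)"
proof (induction Is arbitrary: w)
  case Nil
  then show ?case by (auto simp: sorted_cuts_def compositions_def)
next
  case (Cons I Is)
  have cut: "cut (I @ J) w = cut I (take (sum_list I) w) @ cut J (drop (sum_list I) w)" for J and w :: "'a list"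
    by (induction I arbitrary: w) (simp_all add: take_drop add.commute min_def)
  have "I @ concat Is \<in> sorted_cuts w \<longleftrightarrow> sum_list I \<le> length w \<and>
      I \<in> sorted_cuts (take (sum_list I) w) \<and> concat Is \<in> sorted_cuts (drop (sum_list I) w)"
    by (auto simp: sorted_cuts_def compositions_def cut)
  then show ?case
    unfolding Cons.IH by auto
qed

text \<open>Both double sums run over the same lists \<open>Is\<close>, each exactly once:
  \<open>Is\<close> determines the composition as \<open>concat Is\<close> and the pile sizes as
  \<open>map sum_list Is\<close>.\<close>

lemma sum_sorted_cuts_factorizations:
  fixes G :: "nat list list \<Rightarrow> 'b::comm_monoid_add"
  shows "(\<Sum>J\<in>sorted_cuts w. \<Sum>Is\<in>factorizations a J. G Is) =
    (\<Sum>is | length is = a \<and> sum_list is = length w.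
       \<Sum>Is | list_all2 (\<lambda>I p. I \<in> sorted_cuts p) Is (cut is w). G Is)"
proof -
  have len: "length (cut is w) = length is" for "is" and w :: "'a list"
    by (induction "is" arbitrary: w) auto
  have sums: "map sum_list Is = map length ps" if "list_all2 (\<lambda>I p. I \<in> sorted_cuts p) Is ps"
    for Is and ps :: "'a list list"
    using that by (induction rule: list_all2_induct) (auto simp: sorted_cuts_def compositions_def)
  have unions: "(\<Union>J\<in>sorted_cuts w. factorizations a J) =
      (\<Union>is\<in>{is. length is = a \<and> sum_list is = length w}.
        {Is. list_all2 (\<lambda>I p. I \<in> sorted_cuts p) Is (cut is w)})"
    (is "?A = ?B")
  proof (intro equalityI subsetI)
    fix Is assume "Is \<in> ?A"
    then show "Is \<in> ?B"
      by (intro UN_I[of "map sum_list Is"]) (auto simp: factorizations_def concat_in_sorted_cuts_iff)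
  next
    fix Is assume "Is \<in> ?B"
    then obtain "is" where *: "length is = a" "sum_list is = length w"
        "list_all2 (\<lambda>I p. I \<in> sorted_cuts p) Is (cut is w)" by blast
    then have "map sum_list Is = is"
      using sums concat_and_lengths_of_cut by metis
    then show "Is \<in> ?A"
      using * by (auto simp: factorizations_def concat_in_sorted_cuts_iff)
  qed
  have fin: "finite ?A" by (auto simp: finite_factorizations)
  have "(\<Sum>J\<in>sorted_cuts w. \<Sum>Is\<in>factorizations a J. G Is) = (\<Sum>Is\<in>?A. G Is)"
    by (subst sum.UNION_disjoint) (auto simp: factorizations_def[of a] finite_factorizations[unfolded factorizations_def])
  also have "\<dots> = (\<Sum>is | length is = a \<and> sum_list is = length w.
       \<Sum>Is | list_all2 (\<lambda>I p. I \<in> sorted_cuts p) Is (cut is w). G Is)"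
    unfolding unions
  proof (rule sum.UNION_disjoint)
    show "finite {is. length is = a \<and> sum_list is = length w}" by (rule finite_cuts)
    \<comment> \<open>Each set lies inside the union, which is finite by its other
      description.\<close>
    show "\<forall>is\<in>{is. length is = a \<and> sum_list is = length w}.
        finite {Is. list_all2 (\<lambda>I p. I \<in> sorted_cuts p) Is (cut is w)}"
      using finite_subset[OF _ fin[unfolded unions]] by blast
    show "\<forall>is\<in>{is. length is = a \<and> sum_list is = length w}.
       \<forall>js\<in>{is. length is = a \<and> sum_list is = length w}. is \<noteq> js \<longrightarrow>
        {Is. list_all2 (\<lambda>I p. I \<in> sorted_cuts p) Is (cut is w)} \<inter>
        {Is. list_all2 (\<lambda>I p. I \<in> sorted_cuts p) Is (cut js w)} = {}"
    proof (intro ballI impI)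
      fix "is" js assume *: "is \<in> {is. length is = a \<and> sum_list is = length w}"
        "js \<in> {is. length is = a \<and> sum_list is = length w}" "is \<noteq> js"
      then have "map length (cut is w) \<noteq> map length (cut js w)"
        by (simp add: concat_and_lengths_of_cut)
      then show "{Is. list_all2 (\<lambda>I p. I \<in> sorted_cuts p) Is (cut is w)} \<inter>
        {Is. list_all2 (\<lambda>I p. I \<in> sorted_cuts p) Is (cut js w)} = {}"
        by (auto dest!: sums)
    qed
  qed
  finally show ?thesis .
qed

text \<open>The product on the right is multiplied out, with one sorted cut chosen for each
  pile.\<close>

lemma sum_list_all2_series_prod_list:
  "(\<Sum>Is | list_all2 (\<lambda>I p. I \<in> sorted_cuts p) Is ps. series_prod_list (map mono_qs Is)) =
    series_prod_list (map (\<lambda>p. fund_qs (Des p)) ps)"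
proof (induction ps)
  case (Cons p ps)
  let ?S = "\<lambda>ps. {Is. list_all2 (\<lambda>I p. I \<in> sorted_cuts p) Is ps}"
  have "?S (p # ps) = (\<lambda>(I, Is). I # Is) ` (sorted_cuts p \<times> ?S ps)"
    by (auto simp: list_all2_Cons2)
  then have "(\<Sum>Is\<in>?S (p # ps). series_prod_list (map mono_qs Is)) =
      (\<Sum>(I, Is)\<in>sorted_cuts p \<times> ?S ps. series_mult (mono_qs I) (series_prod_list (map mono_qs Is)))"
    by (simp add: sum.reindex inj_on_def case_prod_beta)
  also have "\<dots> = (\<Sum>I\<in>sorted_cuts p. \<Sum>Is\<in>?S ps. series_mult (mono_qs I) (series_prod_list (map mono_qs Is)))"
    by (simp add: sum.cartesian_product)
  also have "\<dots> = series_mult (fund_qs (Des p)) (series_prod_list (map (\<lambda>p. fund_qs (Des p)) ps))"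
    unfolding Cons.IH[symmetric]
    by (simp only: fund_qs_Des[of p] series_mult_sum_left series_mult_sum_right) (rule sum.swap)
  finally show ?case by simp
qed simp

lemma hopf_power_fund_qs:
  assumes "1 \<le> a" "distinct w"
  shows "hopf_power a (fund_qs (Des w)) =
    (\<Sum>is | length is = a \<and> sum_list is = length w. \<Sum>w'\<in>interleavings (cut is w). fund_qs (Des w'))"
proof -
  have "hopf_power a (fund_qs (Des w)) = (\<Sum>J\<in>sorted_cuts w. hopf_power a (mono_qs J))"
    by (simp add: fund_qs_Des linear_sum[OF linear_hopf_power[OF assms(1)]])
  also have "\<dots> = (\<Sum>J\<in>sorted_cuts w. \<Sum>Is\<in>factorizations a J. series_prod_list (map mono_qs Is))"
    using sorted_cuts_subset_mono_index by (intro sum.cong hopf_power_mono_qs[OF assms(1)]) auto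
  also have "\<dots> = (\<Sum>is | length is = a \<and> sum_list is = length w.
      series_prod_list (map (\<lambda>p. fund_qs (Des p)) (cut is w)))"
    by (simp add: sum_sorted_cuts_factorizations sum_list_all2_series_prod_list)
  also have "\<dots> = (\<Sum>is | length is = a \<and> sum_list is = length w. \<Sum>w'\<in>interleavings (cut is w). fund_qs (Des w'))"
    using assms(2) by (intro sum.cong series_prod_list_fund_qs) (auto simp: concat_and_lengths_of_cut)
  finally show ?thesis .
qed

section \<open>The fundamental basis and the transition matrix\<close>

text \<open>Positive parts of \<open>I\<close> come from nonempty blocks of \<open>J\<close>, so
  there are at most as many blocks as parts of \<open>J\<close>; equality forces every block to be a
  singleton.\<close>

lemma
  assumes "refines J I" "\<forall>i\<in>set I. 0 < i"
  shows refines_length: "length I \<le> length J"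
    and refines_length_eq: "length I = length J \<Longrightarrow> I = J"
proof -
  from assms(1) obtain Js where Js: "J = concat Js" "I = map sum_list Js"
    by (auto simp: refines_def)
  have "length Js \<le> length (concat Js) \<and> (length Js = length (concat Js) \<longrightarrow> map sum_list Js = concat Js)"
    using assms(2) unfolding Js(2)
  proof (induction Js)
    case (Cons K Js)
    then have "K \<noteq> []" and IH: "length Js \<le> length (concat Js)"
      "length Js = length (concat Js) \<longrightarrow> map sum_list Js = concat Js" by auto
    then obtain k K' where K: "K = k # K'" by (cases K) auto
    show ?case using IH by (cases K') (auto simp: K)
  qed simp
  then show "length I \<le> length J" "length I = length J \<Longrightarrow> I = J"
    by (auto simp: Js)
qed

lemma refines_refl: "refines I I"
  unfolding refines_def by (intro exI[of _ "map (\<lambda>i. [i]) I"]) (simp add: concat_map_singleton o_def)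

text \<open>Among the \<open>mono_qs K\<close>, only \<open>mono_qs J\<close> contains the monomial
  with exponents \<open>J\<close> in the first variables, so this evaluation extracts the
  coefficient of \<open>mono_qs J\<close>.\<close>

lemma fund_qs_monomial:
  assumes "I \<in> compositions n" "J \<in> compositions n"
  shows "fund_qs I (monomial [0..<length J] J) = of_bool (refines J I)"
proof -
  have idx: "K \<in> mono_index" if "K \<in> compositions n" for K
    using that by (auto simp: mono_index_def)
  have "fund_qs I (monomial [0..<length J] J) =
      (\<Sum>K | K \<in> compositions n \<and> refines K I. mono_qs K (monomial [0..<length J] J))"
    using assms by (simp add: fund_qs_def sum_fun_apply compositions_def)
  also have "\<dots> = (\<Sum>K | K \<in> compositions n \<and> refines K I. if K = J then 1 else 0)"
    using assms by (intro sum.cong) (auto simp: mono_qs_dual idx)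
  also have "\<dots> = of_bool (refines J I)"
    using assms by (simp add: sum.delta)
  finally show ?thesis .
qed

text \<open>Equal functions contain the same monomials, so each composition refines the other; their
  lengths then agree, which forces equality.\<close>

lemma inj_on_fund_qs: "inj_on fund_qs (compositions n)"
proof (rule inj_onI)
  fix I J assume IJ: "I \<in> compositions n" "J \<in> compositions n" and eq: "fund_qs I = fund_qs J"
  have "refines J I" "refines I J"
    using fund_qs_monomial[OF IJ] fund_qs_monomial[OF IJ(2) IJ(2)]
      fund_qs_monomial[OF IJ(2,1)] fund_qs_monomial[OF IJ(1) IJ(1)] eq refines_refl by auto
  moreover have pos: "\<forall>i\<in>set I. 0 < i" "\<forall>i\<in>set J. 0 < i"
    using IJ by (simp_all add: compositions_def)
  ultimately show "I = J"
    by (intro refines_length_eq[OF \<open>refines J I\<close> pos(1)] antisym refines_length)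
qed

text \<open>In a vanishing combination, the coefficient of \<open>mono_qs I\<close> is the sum of
  the scalars of all \<open>K\<close> refined by \<open>I\<close>. Apart from \<open>I\<close>
  itself these are shorter, so induction on the length removes them.\<close>

lemma independent_fund_qs: "independent (fund_qs ` compositions n)"
proof -
  have zero: "u I = 0" if 0: "(\<Sum>I\<in>compositions n. u I *\<^sub>R fund_qs I) = 0" and I: "I \<in> compositions n" for u I
    using I
  proof (induction "length I" arbitrary: I rule: less_induct)
    case less
    have "0 = (\<Sum>K\<in>compositions n. u K *\<^sub>R fund_qs K) (monomial [0..<length I] I)"
      by (simp add: 0)
    also have "\<dots> = (\<Sum>K\<in>compositions n. u K * of_bool (refines I K))"
      using less.prems by (simp add: sum_fun_apply scaleR_fun_def fund_qs_monomial)
    also have "\<dots> = (\<Sum>K\<in>compositions n. if K = I then u I else 0)"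
    proof (rule sum.cong)
      fix K assume K: "K \<in> compositions n"
      then have pos: "\<forall>i\<in>set K. 0 < i" by (simp add: compositions_def)
      have "u K = 0" if "refines I K" "K \<noteq> I"
        using refines_length[OF that(1) pos] refines_length_eq[OF that(1) pos] that(2) less.hyps[OF _ K]
        by linarith
      then show "u K * of_bool (refines I K) = (if K = I then u I else 0)"
        by (auto simp: refines_refl)
    qed simp
    also have "\<dots> = u I" using less.prems by simp
    finally show ?case by simp
  qed
  show ?thesis
  proof (rule real_vector.independent_if_scalars_zero)
    fix u F assume 0: "(\<Sum>F\<in>fund_qs ` compositions n. u F *\<^sub>R F) = 0" and "F \<in> fund_qs ` compositions n"
    then obtain I where I: "I \<in> compositions n" "F = fund_qs I" by blast
    have "(\<Sum>I\<in>compositions n. u (fund_qs I) *\<^sub>R fund_qs I) = 0"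
      using 0 by (simp add: sum.reindex[OF inj_on_fund_qs])
    then show "u F = 0"
      using zero[of "\<lambda>I. u (fund_qs I)"] I by simp
  qed simp
qed

section \<open>Coefficients of the Hopf power\<close>

text \<open>The normalised Hopf power is a sum over decks weighted by shuffle probabilities. Reading
  off a fundamental coefficient is linear and collects the decks with the same descent
  composition.\<close>

lemma hopf_power_matrix_Des:
  assumes "1 \<le> a" "w \<in> permutations_of_set D" "J \<in> compositions (card D)"
  shows "hopf_power_matrix a (card D) (Des w) J =
    (\<Sum>w' | w' \<in> permutations_of_set D \<and> Des w' = J. riffle_prob a w w')"
proof -
  let ?n = "card D" and ?S = "permutations_of_set D" and ?B = "fund_qs ` compositions (card D)"
  have w: "distinct w" "set w = D" "length w = ?n"
    using assms(2) by (auto simp: permutations_of_set_def distinct_card)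
  \<comment> \<open>Every interleaving is a deck on \<open>D\<close>, so sums over interleavings
    become sums over all decks with an indicator, and the summation order can then be
    exchanged.\<close>
  have int: "interleavings (cut is w) \<subseteq> ?S" if "sum_list is = ?n" for "is"
  proof
    fix w' assume w': "w' \<in> interleavings (cut is w)"
    have "mset w' = mset w"
      using mset_interleavings[OF w'] concat_and_lengths_of_cut[of "is" w] that w(3) by simp
    then show "w' \<in> ?S"
      using w(1,2) mset_eq_setD mset_eq_imp_distinct_iff
      unfolding permutations_of_set_def by blast
  qed
  have DesS: "Des w' \<in> compositions ?n" if "w' \<in> ?S" for w'
    using Des_in_compositions[of w'] that by (simp add: length_finite_permutations_of_set)
  have "(1 / real a ^ ?n) *\<^sub>R hopf_power a (fund_qs (Des w)) =
      (\<Sum>is | length is = a \<and> sum_list is = ?n. \<Sum>w'\<in>interleavings (cut is w).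
        (1 / real a ^ ?n) *\<^sub>R fund_qs (Des w'))"
    using w by (simp add: hopf_power_fund_qs[OF assms(1)] scaleR_sum_right)
  also have "\<dots> = (\<Sum>is | length is = a \<and> sum_list is = ?n. \<Sum>w'\<in>?S.
        (of_bool (w' \<in> interleavings (cut is w)) / real a ^ ?n) *\<^sub>R fund_qs (Des w'))"
    using int by (intro sum.cong sum.mono_neutral_cong_left) auto
  also have "\<dots> = (\<Sum>w'\<in>?S. \<Sum>is | length is = a \<and> sum_list is = ?n.
        (of_bool (w' \<in> interleavings (cut is w)) / real a ^ ?n) *\<^sub>R fund_qs (Des w'))"
    by (rule sum.swap)
  also have "\<dots> = (\<Sum>w'\<in>?S. riffle_prob a w w' *\<^sub>R fund_qs (Des w'))"
    unfolding riffle_prob_distinct[OF w(1)] scaleR_sum_left w(3) ..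
  finally have expand: "(1 / real a ^ ?n) *\<^sub>R hopf_power a (fund_qs (Des w)) =
    (\<Sum>w'\<in>?S. riffle_prob a w w' *\<^sub>R fund_qs (Des w'))" .
  have span: "fund_qs (Des w') \<in> span ?B" if "w' \<in> ?S" for w'
    using DesS[OF that] by (intro span_base) blast
  have "hopf_power_matrix a ?n (Des w) J =
      (\<Sum>w'\<in>?S. riffle_prob a w w' * representation ?B (fund_qs (Des w')) (fund_qs J))"
    unfolding hopf_power_matrix_def expand
    using span by (simp add: real_vector.representation_sum real_vector.representation_scale
        independent_fund_qs span_scale)
  also have "\<dots> = (\<Sum>w'\<in>?S. if Des w' = J then riffle_prob a w w' else 0)"
  proof (rule sum.cong)
    fix w' assume "w' \<in> ?S"
    then have "Des w' \<in> compositions ?n" by (rule DesS)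
    then show "riffle_prob a w w' * representation ?B (fund_qs (Des w')) (fund_qs J) =
        (if Des w' = J then riffle_prob a w w' else 0)"
      using assms(3) inj_on_fund_qs[of ?n]
      by (auto simp: real_vector.representation_basis independent_fund_qs dest: inj_onD)
  qed simp
  also have "\<dots> = (\<Sum>w' | w' \<in> ?S \<and> Des w' = J. riffle_prob a w w')"
    by (intro sum.mono_neutral_cong_right) auto
  finally show ?thesis .
qed

section \<open>Lumping of Markov chains\<close>

text \<open>This is the strong lumpability criterion: the probability of entering a fibre of
  \<open>f\<close> depends only on the fibre of the current state. Conditioning on a history of
  images is treated by summing over all histories in \<open>S\<close> above it.\<close>

lemma markov_chain_lump:
  assumes mc: "markov_chain M S P X" and surj: "f ` S = T"
    and lump: "\<And>x y. x \<in> S \<Longrightarrow> y \<in> T \<Longrightarrow> (\<Sum>x' | x' \<in> S \<and> f x' = y. P x x') = K (f x) y"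
  shows "markov_chain M T K (\<lambda>m \<omega>. f (X m \<omega>))"
proof -
  interpret prob_space M using mc by (simp add: markov_chain_def)
  have finS: "finite S" and stoch: "stochastic_on S P"
    and meas [measurable]: "\<And>m. X m \<in> measurable M (count_space S)"
    and step: "\<And>m x y. (\<forall>i\<le>m. x i \<in> S) \<Longrightarrow> y \<in> S \<Longrightarrow> \<P>(\<omega> in M. \<forall>i\<le>m. X i \<omega> = x i) > 0 \<Longrightarrow>
        \<P>(\<omega> in M. X (Suc m) \<omega> = y \<bar> \<forall>i\<le>m. X i \<omega> = x i) = P (x m) y"
    using mc by (auto simp: markov_chain_def)
  have XS: "X m \<omega> \<in> S" if "\<omega> \<in> space M" for m \<omega>
    using measurable_space[OF meas that] by simp
  have event: "{\<omega> \<in> space M. Q (X m \<omega>)} \<in> events" for Q m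
    by (rule measurable_compose[OF meas, of Q "count_space UNIV", THEN pred_def[THEN iffD1]]) simp
  have events: "{\<omega> \<in> space M. \<forall>i\<le>m. Q i (X i \<omega>)} \<in> events" for Q m
    using sets.sets_Collect_finite_All[of "{..m}" M "\<lambda>i \<omega>. Q i (X i \<omega>)"] event
    by (simp add: Ball_def)
  show ?thesis
    unfolding markov_chain_def
  proof (intro conjI allI impI)
    show "prob_space M" by unfold_locales
    show "finite T" using finS surj by blast
    show "stochastic_on T K"
      unfolding stochastic_on_def
    proof (intro ballI conjI)
      fix y assume "y \<in> T"
      \<comment> \<open>The row of \<open>K\<close> at \<open>y\<close> inherits nonnegativity and
        total mass from the row of \<open>P\<close> at any preimage.\<close>
      then obtain x where x: "x \<in> S" "y = f x" using surj by blast
      have P0: "0 \<le> P x x'" if "x' \<in> S" for x'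
        using stoch x that by (simp add: stochastic_on_def)
      show "0 \<le> K y z" if "z \<in> T" for z
        unfolding x(2) lump[OF x(1) that, symmetric] by (rule sum_nonneg) (simp add: P0)
      have "(\<Sum>z\<in>T. K y z) = (\<Sum>z\<in>T. \<Sum>x' | x' \<in> S \<and> f x' = z. P x x')"
        by (simp add: x lump)
      also have "\<dots> = (\<Sum>x'\<in>S. P x x')"
        using finS surj by (intro sum.group) auto
      also have "\<dots> = 1" using stoch x by (simp add: stochastic_on_def)
      finally show "(\<Sum>z\<in>T. K y z) = 1" .
    qed
    show "(\<lambda>\<omega>. f (X m \<omega>)) \<in> measurable M (count_space T)" for m
      by (rule measurable_compose[OF meas]) (use surj in auto)
    fix m y z
    assume *: "(\<forall>i\<le>m. y i \<in> T) \<and> z \<in> T \<and> \<P>(\<omega> in M. \<forall>i\<le>m. f (X i \<omega>) = y i) > 0"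
    \<comment> \<open>The histories up to time \<open>m\<close> that lie above \<open>y\<close>.
      \<open>PiE\<close> fixes their values beyond \<open>m\<close>, so that distinct histories
      describe disjoint events.\<close>
    define W where "W = PiE {..m} (\<lambda>i. {s \<in> S. f s = y i})"
    have W: "x i \<in> S" "f (x i) = y i" if "x \<in> W" "i \<le> m" for x i
      using that by (auto simp: W_def PiE_def Pi_def)
    have finW: "finite W" unfolding W_def using finS by (intro finite_PiE) auto
    let ?A = "\<lambda>x. {\<omega> \<in> space M. \<forall>i\<le>m. X i \<omega> = x i}"
    let ?Z = "{s. s \<in> S \<and> f s = z}"
    have disj: "x = x'" if "x \<in> W" "x' \<in> W" "\<omega> \<in> ?A x" "\<omega> \<in> ?A x'" for x x' \<omega>
    proof (rule PiE_ext)
      show "x \<in> PiE {..m} (\<lambda>i. {s \<in> S. f s = y i})" "x' \<in> PiE {..m} (\<lambda>i. {s \<in> S. f s = y i})"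
        using that by (simp_all add: W_def)
    qed (use that in auto)
    have path: "\<exists>x\<in>W. \<omega> \<in> ?A x" if "\<omega> \<in> space M" "\<forall>i\<le>m. f (X i \<omega>) = y i" for \<omega>
      using that XS by (intro bexI[of _ "restrict (\<lambda>i. X i \<omega>) {..m}"]) (auto simp: W_def)
    have B: "{\<omega> \<in> space M. \<forall>i\<le>m. f (X i \<omega>) = y i} = (\<Union>x\<in>W. ?A x)"
      using path W by fastforce
    have C: "{\<omega> \<in> space M. f (X (Suc m) \<omega>) = z \<and> (\<forall>i\<le>m. f (X i \<omega>) = y i)} =
        (\<Union>(x, s)\<in>W \<times> ?Z. {\<omega> \<in> space M. X (Suc m) \<omega> = s \<and> (\<forall>i\<le>m. X i \<omega> = x i)})"
      using path W XS by fastforce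
    \<comment> \<open>Null histories are treated separately, since the Markov property speaks only
      of histories of positive probability; for them both sides are 0.\<close>
    have joint: "prob {\<omega> \<in> space M. X (Suc m) \<omega> = s \<and> (\<forall>i\<le>m. X i \<omega> = x i)} = prob (?A x) * P (x m) s"
      if "x \<in> W" "s \<in> ?Z" for x s
    proof (cases "prob (?A x) = 0")
      case True
      have "prob {\<omega> \<in> space M. X (Suc m) \<omega> = s \<and> (\<forall>i\<le>m. X i \<omega> = x i)} \<le> prob (?A x)"
        using events[of m "\<lambda>i a. a = x i"] by (intro finite_measure_mono) auto
      then show ?thesis using True measure_nonneg[of M] by (simp add: order_antisym)
    next
      case False
      then have "prob (?A x) > 0" using measure_nonneg[of M] by (simp add: order.strict_iff_order)
      then have "cond_prob M (\<lambda>\<omega>. X (Suc m) \<omega> = s) (\<lambda>\<omega>. \<forall>i\<le>m. X i \<omega> = x i) = P (x m) s"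
        using step[of m x s] W(1)[OF that(1)] that(2) by simp
      then show ?thesis using False by (simp add: cond_prob_def field_simps)
    qed
    have ev: "{\<omega> \<in> space M. X (Suc m) \<omega> = s \<and> (\<forall>i\<le>m. X i \<omega> = x i)} \<in> events" for x s
      using sets.Int[OF event[of "\<lambda>a. a = s" "Suc m"] events[of m "\<lambda>i a. a = x i"]]
      by (rule back_subst[of "\<lambda>A. A \<in> events"]) auto
    have "prob {\<omega> \<in> space M. f (X (Suc m) \<omega>) = z \<and> (\<forall>i\<le>m. f (X i \<omega>) = y i)} =
        (\<Sum>(x, s)\<in>W \<times> ?Z. prob {\<omega> \<in> space M. X (Suc m) \<omega> = s \<and> (\<forall>i\<le>m. X i \<omega> = x i)})"
      unfolding C case_prod_beta
    proof (rule finite_measure_finite_Union)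
      show "disjoint_family_on (\<lambda>p. {\<omega> \<in> space M. X (Suc m) \<omega> = snd p \<and> (\<forall>i\<le>m. X i \<omega> = fst p i)}) (W \<times> ?Z)"
        unfolding disjoint_family_on_def
      proof (intro ballI impI equals0I)
        fix p q \<omega>
        assume pq: "p \<in> W \<times> ?Z" "q \<in> W \<times> ?Z" "p \<noteq> q" and
          "\<omega> \<in> {\<omega> \<in> space M. X (Suc m) \<omega> = snd p \<and> (\<forall>i\<le>m. X i \<omega> = fst p i)} \<inter>
            {\<omega> \<in> space M. X (Suc m) \<omega> = snd q \<and> (\<forall>i\<le>m. X i \<omega> = fst q i)}"
        then have "\<omega> \<in> ?A (fst p)" "\<omega> \<in> ?A (fst q)" "snd p = snd q"
          by auto
        moreover have "fst p \<in> W" "fst q \<in> W"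
          using pq by auto
        ultimately show False
          using disj pq(3) by (auto simp: prod_eq_iff)
      qed
    qed (use finW finS ev in auto)
    also have "\<dots> = (\<Sum>(x, s)\<in>W \<times> ?Z. prob (?A x) * P (x m) s)"
      by (rule sum.cong) (auto simp: joint)
    also have "\<dots> = (\<Sum>x\<in>W. prob (?A x) * (\<Sum>s\<in>?Z. P (x m) s))"
      by (simp add: sum.cartesian_product[symmetric] sum_distrib_left)
    \<comment> \<open>Here lumpability enters: the inner sum is the same for all histories, as they
      all end above \<open>y m\<close>.\<close>
    also have "\<dots> = (\<Sum>x\<in>W. prob (?A x) * K (y m) z)"
      using * by (intro sum.cong) (simp_all add: lump W)
    also have "\<dots> = prob (\<Union>x\<in>W. ?A x) * K (y m) z"
      unfolding sum_distrib_right[symmetric]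
    proof (subst finite_measure_finite_Union)
      show "disjoint_family_on ?A W"
        unfolding disjoint_family_on_def using disj by blast
      show "?A ` W \<subseteq> events" using events[of m "\<lambda>i a. a = _ i"] by auto
    qed (use finW in auto)
    finally show "\<P>(\<omega> in M. f (X (Suc m) \<omega>) = z \<bar> \<forall>i\<le>m. f (X i \<omega>) = y i) = K (y m) z"
      using * by (simp add: cond_prob_def B)
  qed
qed

theorem theorem6p2p2:
  fixes a n :: nat and D :: "'a::linorder set"
  assumes "1 \<le> a" and "finite D" and "card D = n"
  shows "(\<forall>w \<in> permutations_of_set D. \<forall>J \<in> compositions n.
            (\<Sum>w' | w' \<in> permutations_of_set D \<and> Des w' = J. riffle_prob a w w')
              = hopf_power_matrix a n (Des w) J) \<and>
         (\<forall>(M :: 'w measure) X.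
            markov_chain M (permutations_of_set D) (riffle_prob a) X \<longrightarrow>
            markov_chain M (compositions n) (hopf_power_matrix a n) (\<lambda>m \<omega>. Des (X m \<omega>)))"
proof (intro conjI allI impI ballI)
  show "(\<Sum>w' | w' \<in> permutations_of_set D \<and> Des w' = J. riffle_prob a w w') =
      hopf_power_matrix a n (Des w) J"
    if "w \<in> permutations_of_set D" "J \<in> compositions n" for w J
    using hopf_power_matrix_Des[OF assms(1), of w D J] that assms(3) by simp
  fix M :: "'w measure" and X
  assume "markov_chain M (permutations_of_set D) (riffle_prob a) X"
  then show "markov_chain M (compositions n) (hopf_power_matrix a n) (\<lambda>m \<omega>. Des (X m \<omega>))"
  proof (rule markov_chain_lump)
    \<comment> \<open>Every composition has to occur, because the lumped matrix must be stochastic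
      on all of \<open>compositions n\<close>.\<close>
    show "Des ` permutations_of_set D = compositions n"
      using Des_surj[OF assms(2)] Des_in_compositions[where 'a = 'a] assms(3)
      by (fastforce simp flip: length_finite_permutations_of_set)
    show "(\<Sum>w' | w' \<in> permutations_of_set D \<and> Des w' = J. riffle_prob a w w') =
        hopf_power_matrix a n (Des w) J"
      if "w \<in> permutations_of_set D" "J \<in> compositions n" for w J
      using hopf_power_matrix_Des[OF assms(1), of w D J] that assms(3) by simp
  qed
qed

end
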